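(* Let $m\ge3$ and $d\ge0$. The dimension of $((V^1)^{\otimes d})^{\mathcal D_m}\simeq\mathbb R\langle x_1,x_2\rangle_d^{\mathcal D_m}$ is equal to the number of words of length $d$ which reduce to the identity in the Cayley graph $\Gamma(\mathcal D_m,\{r,s\})$.
   Context: $\mathcal D_m=\langle s,r\mid s^2=r^m=srsr=e\rangle$ is the dihedral group of order $2m$. $V^1$ is its geometric module: the two-dimensional real simple module on which $r$ acts as rotation by $2\pi/m$ and $s$ as a reflection (character $\chi_1(r^a)=2\cos(2\pi a/m)$, $\chi_1(r^as)=0$). With $x_1,x_2$ a basis of $V^1$, the tensor algebra $T(V^1)$ is identified with the non-commutative polynomial algebra $\mathbb R\langle x_1,x_2\rangle$, with diagonal group action; the subscript $d$ denotes the degree-$d$ component and the superscript $\mathcal D_m$ the subspace of invariants. In the Cayley graph $\Gamma(G,S)$ there is a directed edge $g\to gs$ for each $g\in G,s\in S$; a word of length $d$ which reduces to $g$ is a sequence $(s_1,\dots,s_d)\in S^d$ with $s_1\cdots s_d=g$ in $G$. *)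

theory Defs
  imports "HOL-Analysis.Analysis" "HOL-Algebra.Group" "HOL-Library.Poly_Mapping"
begin

section \<open>Groups given by generators and relators\<close>

datatype 'x letter = Gen 'x | Inv 'x

text \<open>
  Equality of two group words in the group presented by the relators \<open>R\<close>: the least congruence
  on the monoid of words that contains the free cancellations and trivialises every relator.
\<close>

inductive pres_eq :: "'x letter list set \<Rightarrow> 'x letter list \<Rightarrow> 'x letter list \<Rightarrow> bool"
  for R :: "'x letter list set"
where
  refl: "pres_eq R u u"
| sym: "pres_eq R u v \<Longrightarrow> pres_eq R v u"
| trans: "pres_eq R u v \<Longrightarrow> pres_eq R v w \<Longrightarrow> pres_eq R u w"
| cong: "pres_eq R u v \<Longrightarrow> pres_eq R (a @ u @ b) (a @ v @ b)"
| cancel_right: "pres_eq R [Gen x, Inv x] []"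
| cancel_left: "pres_eq R [Inv x, Gen x] []"
| relator: "r \<in> R \<Longrightarrow> pres_eq R r []"

definition pres_class :: "'x letter list set \<Rightarrow> 'x letter list \<Rightarrow> 'x letter list set" where
  "pres_class R u = {v. pres_eq R u v}"

definition presented_group :: "'x letter list set \<Rightarrow> 'x letter list set monoid" where
  "presented_group R =
     \<lparr>carrier = range (pres_class R),
      mult = (\<lambda>X Y. \<Union>u\<in>X. \<Union>v\<in>Y. pres_class R (u @ v)),
      one = pres_class R []\<rparr>"

lemma pres_class_eq_iff: "pres_class R u = pres_class R v \<longleftrightarrow> pres_eq R u v"
  unfolding pres_class_def by (auto intro: pres_eq.refl pres_eq.sym pres_eq.trans)

lemma pres_eq_append:
  assumes "pres_eq R u u'" "pres_eq R v v'"
  shows "pres_eq R (u @ v) (u' @ v')"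
  using pres_eq.cong[OF assms(1), of "[]" v] pres_eq.cong[OF assms(2), of u' "[]"]
  by (auto intro: pres_eq.trans)

lemma presented_group_mult:
  "pres_class R u \<otimes>\<^bsub>presented_group R\<^esub> pres_class R v = pres_class R (u @ v)"
proof -
  have "pres_class R (u' @ v') = pres_class R (u @ v)"
    if "u' \<in> pres_class R u" "v' \<in> pres_class R v" for u' v'
  proof -
    have "pres_eq R (u @ v) (u' @ v')"
      using that by (intro pres_eq_append) (simp_all add: pres_class_def)
    then show ?thesis
      by (simp add: pres_class_eq_iff pres_eq.sym)
  qed
  moreover have "u \<in> pres_class R u" "v \<in> pres_class R v"
    by (simp_all add: pres_class_def pres_eq.refl)
  ultimately have "(\<Union>u'\<in>pres_class R u. \<Union>v'\<in>pres_class R v. pres_class R (u' @ v'))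
      = pres_class R (u @ v)"
    by blast
  then show ?thesis
    by (simp add: presented_group_def)
qed


section \<open>The dihedral group\<close>

datatype dihedral_gen = Rot | Ref

definition dihedral_relators :: "nat \<Rightarrow> dihedral_gen letter list set" where
  "dihedral_relators m =
     {[Gen Ref, Gen Ref], replicate m (Gen Rot), [Gen Ref, Gen Rot, Gen Ref, Gen Rot]}"

definition dihedral_group :: "nat \<Rightarrow> dihedral_gen letter list set monoid" where
  "dihedral_group m = presented_group (dihedral_relators m)"

definition rot :: "nat \<Rightarrow> dihedral_gen letter list set" where
  "rot m = pres_class (dihedral_relators m) [Gen Rot]"

definition ref :: "nat \<Rightarrow> dihedral_gen letter list set" where
  "ref m = pres_class (dihedral_relators m) [Gen Ref]"

text \<open>Walks of length \<open>d\<close> from the identity to \<open>g\<close> in the Cayley graph (edges \<open>h \<rightarrow> h s\<close> for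
  \<open>s \<in> S\<close>), recorded by their labels.\<close>

definition words_reducing_to ::
    "('g, 'b) monoid_scheme \<Rightarrow> 'g set \<Rightarrow> nat \<Rightarrow> 'g \<Rightarrow> 'g list set" where
  "words_reducing_to G S d g =
     {ws. length ws = d \<and> set ws \<subseteq> S \<and> foldr (\<lambda>x y. x \<otimes>\<^bsub>G\<^esub> y) ws \<one>\<^bsub>G\<^esub> = g}"


section \<open>Representations and invariants\<close>

definition representation_on ::
    "('g, 'b) monoid_scheme \<Rightarrow> ('g \<Rightarrow> 'v::real_vector \<Rightarrow> 'v) \<Rightarrow> bool" where
  "representation_on G \<rho> \<longleftrightarrow>
     (\<forall>g\<in>carrier G. linear (\<rho> g)) \<and>
     \<rho> \<one>\<^bsub>G\<^esub> = id \<and>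
     (\<forall>g\<in>carrier G. \<forall>h\<in>carrier G. \<rho> (g \<otimes>\<^bsub>G\<^esub> h) = \<rho> g \<circ> \<rho> h)"

text \<open>
  The geometric module, with the Euclidean plane realised as \<^typ>\<open>complex\<close> regarded as a real vector
  space. The map \<open>z \<mapsto> cis \<phi> * cnj z\<close> is the reflection in the line through \<open>0\<close> at angle
  \<open>\<phi> / 2\<close>; every linear reflection of the plane has this form.
\<close>

definition geometric_module ::
    "nat \<Rightarrow> (dihedral_gen letter list set \<Rightarrow> complex \<Rightarrow> complex) \<Rightarrow> bool" where
  "geometric_module m \<rho> \<longleftrightarrow>
     representation_on (dihedral_group m) \<rho> \<and>
     \<rho> (rot m) = (\<lambda>z. cis (2 * pi / real m) * z) \<and>
     (\<exists>\<phi>. \<rho> (ref m) = (\<lambda>z. cis \<phi> * cnj z))"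

definition invariants ::
    "('g, 'b) monoid_scheme \<Rightarrow> ('g \<Rightarrow> 'w \<Rightarrow> 'w) \<Rightarrow> 'w set \<Rightarrow> 'w set" where
  "invariants G act W = {w \<in> W. \<forall>g\<in>carrier G. act g w = w}"

text \<open>The geometric module exists, for every choice of the reflection.\<close>

primrec letter_eval :: "nat \<Rightarrow> real \<Rightarrow> dihedral_gen letter \<Rightarrow> complex \<Rightarrow> complex" where
  "letter_eval m \<phi> (Gen x) =
     (case x of Rot \<Rightarrow> (\<lambda>z. cis (2 * pi / real m) * z) | Ref \<Rightarrow> (\<lambda>z. cis \<phi> * cnj z))"
| "letter_eval m \<phi> (Inv x) =
     (case x of Rot \<Rightarrow> (\<lambda>z. cis (- (2 * pi / real m)) * z) | Ref \<Rightarrow> (\<lambda>z. cis \<phi> * cnj z))"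

lemma linear_letter_eval: "linear (letter_eval m \<phi> l)"
  by (cases l) (auto intro!: linearI simp: algebra_simps split: dihedral_gen.split)

lemma cis_cancel: "cis t * (cis (- t) * z) = z" "cis (- t) * (cis t * z) = z"
  unfolding mult.assoc[symmetric] cis_mult by simp_all

lemma foldr_letter_eval_pres_eq:
  assumes "m > 0" "pres_eq (dihedral_relators m) u v"
  shows "foldr (letter_eval m \<phi>) u = foldr (letter_eval m \<phi>) v"
  using assms(2)
proof (induction rule: pres_eq.induct)
  case (cancel_right x)
  show ?case
    by (cases x) (simp_all add: fun_eq_iff cis_cnj cis_cancel)
next
  case (cancel_left x)
  show ?case
    by (cases x) (simp_all add: fun_eq_iff cis_cnj cis_cancel)
next
  case (relator r)
  have rep: "foldr (letter_eval m \<phi>) (replicate k (Gen Rot)) z = cis (2 * pi / real m) ^ k * z"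
    for k z by (induction k) auto
  have "cis (2 * pi / real m) ^ m = cis (real m * (2 * pi / real m))"
    by (rule Complex.DeMoivre)
  also have "real m * (2 * pi / real m) = 2 * pi"
    using assms(1) by simp
  finally have "cis (2 * pi / real m) ^ m = 1"
    by simp
  then have rots: "foldr (letter_eval m \<phi>) (replicate m (Gen Rot)) = id"
    using rep by (simp add: fun_eq_iff)
  consider "r = [Gen Ref, Gen Ref]" | "r = replicate m (Gen Rot)"
    | "r = [Gen Ref, Gen Rot, Gen Ref, Gen Rot]"
    using relator by (auto simp: dihedral_relators_def)
  then show ?case
  proof cases
    case 2
    then show ?thesis using rots by simp
  qed (simp_all add: fun_eq_iff cis_cnj cis_cancel cis_mult)
qed (auto simp: fun_eq_iff)

lemma geometric_module_exists:
  assumes "m > 0"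
  shows "\<exists>\<rho>. geometric_module m \<rho> \<and> \<rho> (ref m) = (\<lambda>z. cis \<phi> * cnj z)"
proof -
  let ?R = "dihedral_relators m"
  define \<rho> where "\<rho> X = foldr (letter_eval m \<phi>) (SOME w. w \<in> X)" for X
  have \<rho>: "\<rho> (pres_class ?R u) = foldr (letter_eval m \<phi>) u" for u
  proof -
    have "u \<in> pres_class ?R u"
      by (simp add: pres_class_def pres_eq.refl)
    then have "(SOME w. w \<in> pres_class ?R u) \<in> pres_class ?R u"
      by (rule someI)
    then show ?thesis
      unfolding \<rho>_def
      using foldr_letter_eval_pres_eq[OF assms, of u "SOME w. w \<in> pres_class ?R u" \<phi>]
      by (simp add: pres_class_def)
  qed
  have lin: "linear (foldr (letter_eval m \<phi>) u)" for u
  proof (induction u)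
    case Nil
    show ?case
      unfolding foldr.simps(1) by (rule linear_id)
  next
    case (Cons l u)
    show ?case
      unfolding foldr.simps(2) by (rule linear_compose[OF Cons linear_letter_eval])
  qed
  have "\<rho> \<one>\<^bsub>dihedral_group m\<^esub> = id"
    using \<rho>[of "[]"] by (simp add: dihedral_group_def presented_group_def)
  moreover have "carrier (dihedral_group m) = range (pres_class ?R)"
    by (simp add: dihedral_group_def presented_group_def)
  ultimately have "representation_on (dihedral_group m) \<rho>"
    using lin
    by (auto simp: representation_on_def \<rho> dihedral_group_def presented_group_mult fun_eq_iff)
  then show ?thesis
    by (intro exI[of _ \<rho>]) (auto simp: geometric_module_def rot_def ref_def \<rho>)
qed


section \<open>Free algebras\<close>

text \<open>
  Lists form the free monoid, so \<open>'x list \<Rightarrow>\<^sub>0 real\<close> with the convolution product of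
  \<^typ>\<open>'a \<Rightarrow>\<^sub>0 'b\<close> is the algebra of non-commutative polynomials in the variables \<open>'x\<close>.
\<close>

instantiation list :: (type) monoid_add
begin
definition zero_list :: "'a list" where "zero_list = []"
definition plus_list :: "'a list \<Rightarrow> 'a list \<Rightarrow> 'a list" where "plus_list = (@)"
instance by standard (simp_all add: zero_list_def plus_list_def)
end

instantiation poly_mapping :: (type, real_vector) real_vector
begin
lift_definition scaleR_poly_mapping :: "real \<Rightarrow> ('a \<Rightarrow>\<^sub>0 'b) \<Rightarrow> ('a \<Rightarrow>\<^sub>0 'b)"
  is "\<lambda>c p x. c *\<^sub>R p x"
  by (erule finite_subset[rotated]) auto
instance
  by (intro_classes; transfer) (simp_all add: fun_eq_iff scaleR_add_right scaleR_add_left)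
end

type_synonym 'x ncpoly = "'x list \<Rightarrow>\<^sub>0 real"

definition monomial :: "'x list \<Rightarrow> 'x ncpoly" where
  "monomial w = Poly_Mapping.single w 1"

definition homogeneous :: "nat \<Rightarrow> 'x ncpoly set" where
  "homogeneous d = {p. \<forall>w\<in>Poly_Mapping.keys p. length w = d}"

text \<open>The algebra endomorphism with \<open>x \<mapsto> f x\<close> for every variable \<open>x\<close>.\<close>

definition ncpoly_subst :: "('x \<Rightarrow> 'x ncpoly) \<Rightarrow> 'x ncpoly \<Rightarrow> 'x ncpoly" where
  "ncpoly_subst f p = (\<Sum>w\<in>Poly_Mapping.keys p. Poly_Mapping.lookup p w *\<^sub>R prod_list (map f w))"

text \<open>
  Given a basis \<open>b\<close> of \<open>'v\<close> indexed by the variables, \<open>linear_form b v\<close> is \<open>v\<close> written as a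
  linear form in the variables (variable \<open>i\<close> standing for \<open>b i\<close>), and \<open>ncpoly_act b f\<close>
  is the diagonal action of the linear map \<open>f\<close> on the non-commutative polynomials.
\<close>

definition linear_form :: "('x::finite \<Rightarrow> 'v::real_vector) \<Rightarrow> 'v \<Rightarrow> 'x ncpoly" where
  "linear_form b v = (\<Sum>i\<in>UNIV. representation (range b) v (b i) *\<^sub>R monomial [i])"

definition ncpoly_act ::
    "('x::finite \<Rightarrow> 'v::real_vector) \<Rightarrow> ('v \<Rightarrow> 'v) \<Rightarrow> 'x ncpoly \<Rightarrow> 'x ncpoly" where
  "ncpoly_act b f = ncpoly_subst (\<lambda>i. linear_form b (f (b i)))"

definition is_basis :: "('x \<Rightarrow> 'v::real_vector) \<Rightarrow> bool" where
  "is_basis b \<longleftrightarrow> inj b \<and> independent (range b) \<and> span (range b) = UNIV"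

datatype ncvar = X1 | X2

instance ncvar :: finite
proof
  have "(UNIV :: ncvar set) = {X1, X2}" by (auto intro: ncvar.exhaust)
  then show "finite (UNIV :: ncvar set)" by (metis finite.emptyI finite.insertI)
qed


section \<open>Tensor powers\<close>

text \<open>
  The direct sum of all tensor powers of a real vector space: the free vector space on the finite
  sequences of vectors modulo multilinearity.
\<close>

definition multilinear_relations :: "('v::real_vector list \<Rightarrow>\<^sub>0 real) set" where
  "multilinear_relations = span
     ({monomial (as @ [u + v] @ bs) - monomial (as @ [u] @ bs) - monomial (as @ [v] @ bs)
         | as u v bs. True} \<union>
      {monomial (as @ [c *\<^sub>R u] @ bs) - c *\<^sub>R monomial (as @ [u] @ bs) | as c u bs. True})"

definition tensor_rel :: "('v::real_vector list \<Rightarrow>\<^sub>0 real) \<Rightarrow> ('v list \<Rightarrow>\<^sub>0 real) \<Rightarrow> bool" where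
  "tensor_rel p q \<longleftrightarrow> p - q \<in> multilinear_relations"

lemma subspace_multilinear_relations: "subspace multilinear_relations"
  unfolding multilinear_relations_def by (rule subspace_span)

lemma equivp_tensor_rel: "equivp (tensor_rel :: ('v::real_vector list \<Rightarrow>\<^sub>0 real) \<Rightarrow> _)"
  (is "equivp ?R")
proof (rule equivpI)
  note S = subspace_multilinear_relations
  show "reflp ?R"
    by (rule reflpI) (simp add: tensor_rel_def subspace_0[OF S])
  show "symp ?R"
  proof (rule sympI)
    fix p q :: "'v list \<Rightarrow>\<^sub>0 real"
    assume "tensor_rel p q"
    then show "tensor_rel q p"
      using subspace_neg[OF S, of "p - q"] unfolding tensor_rel_def minus_diff_eq by blast
  qed
  show "transp ?R"
  proof (rule transpI)
    fix p q r :: "'v list \<Rightarrow>\<^sub>0 real"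
    assume "tensor_rel p q" "tensor_rel q r"
    moreover have "(p - q) + (q - r) = p - r"
      by simp
    ultimately show "tensor_rel p r"
      using subspace_add[OF S, of "p - q" "q - r"] unfolding tensor_rel_def by simp
  qed
qed

quotient_type (overloaded) 'v tensor_algebra = "'v::real_vector list \<Rightarrow>\<^sub>0 real" / tensor_rel
  by (rule equivp_tensor_rel)

instantiation tensor_algebra :: (real_vector) real_vector
begin

lift_definition zero_tensor_algebra :: "'a tensor_algebra" is 0 .

lift_definition plus_tensor_algebra ::
    "'a tensor_algebra \<Rightarrow> 'a tensor_algebra \<Rightarrow> 'a tensor_algebra" is "(+)"
  unfolding tensor_rel_def add_diff_add by (rule subspace_add[OF subspace_multilinear_relations])

lift_definition uminus_tensor_algebra :: "'a tensor_algebra \<Rightarrow> 'a tensor_algebra" is uminus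
  unfolding tensor_rel_def minus_diff_minus by (rule subspace_neg[OF subspace_multilinear_relations])

lift_definition minus_tensor_algebra ::
    "'a tensor_algebra \<Rightarrow> 'a tensor_algebra \<Rightarrow> 'a tensor_algebra" is "(-)"
proof -
  fix p p' q q' :: "'a list \<Rightarrow>\<^sub>0 real"
  assume "tensor_rel p p'" "tensor_rel q q'"
  moreover have "(p - p') - (q - q') = (p - q) - (p' - q')"
    by (simp add: algebra_simps)
  ultimately show "tensor_rel (p - q) (p' - q')"
    using subspace_diff[OF subspace_multilinear_relations, of "p - p'" "q - q'"]
    unfolding tensor_rel_def by (simp only:)
qed

lift_definition scaleR_tensor_algebra :: "real \<Rightarrow> 'a tensor_algebra \<Rightarrow> 'a tensor_algebra" is "(*\<^sub>R)"
  unfolding tensor_rel_def scaleR_diff_right[symmetric]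
  by (rule subspace_scale[OF subspace_multilinear_relations])

instance
proof -
  have [simp]: "tensor_rel p p" for p :: "'a list \<Rightarrow>\<^sub>0 real"
    using equivp_tensor_rel by (rule equivp_reflp)
  show "OFCLASS('a tensor_algebra, real_vector_class)"
    by (intro_classes; transfer) (simp_all add: algebra_simps)
qed

end

text \<open>\<open>tensor [v\<^sub>1, \<dots>, v\<^sub>d]\<close> is the elementary tensor of \<open>v\<^sub>1, \<dots>, v\<^sub>d\<close>.\<close>

lift_definition tensor :: "'v::real_vector list \<Rightarrow> 'v tensor_algebra" is monomial .

definition tensor_power :: "nat \<Rightarrow> 'v::real_vector tensor_algebra set" where
  "tensor_power d = span {tensor vs | vs. length vs = d}"

text \<open>
  The diagonal action of a linear map \<open>f\<close>: the linear map that sends each elementary tensor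
  \<open>tensor vs\<close> to \<open>tensor (map f vs)\<close>. As \<open>f\<close> is linear, the value does not depend on the
  representative that is chosen.
\<close>

definition tensor_act :: "('v \<Rightarrow> 'v) \<Rightarrow> 'v::real_vector tensor_algebra \<Rightarrow> 'v tensor_algebra" where
  "tensor_act f t =
     (let p = rep_tensor_algebra t in \<Sum>vs\<in>Poly_Mapping.keys p. Poly_Mapping.lookup p vs *\<^sub>R tensor (map f vs))"


definition tensor_invariants ::
    "nat \<Rightarrow> (dihedral_gen letter list set \<Rightarrow> complex \<Rightarrow> complex) \<Rightarrow> nat \<Rightarrow>
     complex tensor_algebra set" where
  "tensor_invariants m \<rho> d =
     invariants (dihedral_group m) (\<lambda>g. tensor_act (\<rho> g)) (tensor_power d)"

definition ncpoly_invariants ::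
    "nat \<Rightarrow> (dihedral_gen letter list set \<Rightarrow> complex \<Rightarrow> complex) \<Rightarrow> (ncvar \<Rightarrow> complex) \<Rightarrow> nat \<Rightarrow>
     ncvar ncpoly set" where
  "ncpoly_invariants m \<rho> b d =
     invariants (dihedral_group m) (\<lambda>g. ncpoly_act b (\<rho> g)) (homogeneous d)"

end

theory Submission
  imports Defs
begin

text \<open>
  Both sides count the same sign sequences. Over the complex numbers the plane has the coordinates
  \<open>\<zeta>\<close> and \<open>cnj \<zeta>\<close>, where \<open>\<zeta> v = cis (- \<phi> / 2) * v\<close> and \<open>\<phi> / 2\<close> is the angle of the axis of the
  reflection. The rotation multiplies them by \<open>cis (2 * pi / m)\<close> and by its inverse, and the
  reflection exchanges them. A list \<open>\<epsilon>\<close> of \<open>d\<close> signs (\<open>True\<close> for \<open>\<zeta>\<close>, \<open>False\<close> for \<open>cnj \<zeta>\<close>) thus gives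
  a form on the tensor power of degree \<open>d\<close>, here \<open>eigencoeff \<phi> \<epsilon>\<close>, which the rotation multiplies by
  \<open>cis (2 * pi * weight \<epsilon> / m)\<close>, with \<open>weight \<epsilon>\<close> the sum of the signs, and which the reflection
  exchanges with the form of the opposite signs. Since the tensors are real, opposite sign lists have
  conjugate coefficients, and a real tensor is determined by its coefficients
  (\<open>tensor_power_eigen_expansion\<close>). Hence a tensor is invariant exactly if all its coefficients are
  real and those at an \<open>\<epsilon>\<close> with \<open>m\<close> not dividing \<open>weight \<epsilon>\<close> vanish. Invariants therefore have a basis
  indexed by the pairs \<open>{\<epsilon>, - \<epsilon>}\<close> with \<open>m dvd weight \<epsilon>\<close>, or, choosing one representative, by such \<open>\<epsilon>\<close>
  that end with \<open>True\<close> or are empty (\<open>dim_tensor_invariants\<close>).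

  On the other side, record after every letter of a word in \<open>r\<close> and \<open>s\<close> whether the number of
  letters \<open>s\<close> read so far is even. This is a bijection from words of length \<open>d\<close> to sign lists of
  length \<open>d\<close>. Moving all letters \<open>s\<close> to the right turns a letter \<open>r\<close> into \<open>r\<close> or its inverse,
  according to the sign at it; the letters \<open>s\<close> carry alternating signs, so that the exponent of \<open>r\<close>
  is the weight of the whole sign list as soon as the number of letters \<open>s\<close> is even, that is, as soon
  as the last sign is \<open>True\<close> or the word is empty. So the word is trivial exactly if its sign list is one of the
  representatives above (\<open>card_words_reducing_to_one\<close>). That no further word is trivial follows from
  the faithfulness of the geometric module.

  Finally, a basis of the plane identifies the tensor algebra with the polynomial algebra, compatibly
  with degrees and with the diagonal actions (\<open>bij_betw_tensor_to_ncpoly_invariants\<close>).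
\<close>

section \<open>Non-commutative polynomials as a free vector space\<close>

text \<open>
  Words are a basis of the non-commutative polynomials, so any function on words extends linearly.
  With lists of vectors in the role of words, the same map describes linear maps on the free vector
  space of which the tensor algebra is a quotient.
\<close>

definition linear_extension :: "('x list \<Rightarrow> 'w::real_vector) \<Rightarrow> 'x ncpoly \<Rightarrow> 'w" where
  "linear_extension g p = (\<Sum>w\<in>Poly_Mapping.keys p. Poly_Mapping.lookup p w *\<^sub>R g w)"

lemma lookup_scaleR [simp]:
  "Poly_Mapping.lookup (c *\<^sub>R p) w = c *\<^sub>R Poly_Mapping.lookup p w"
  by transfer simp

lemma linear_extension_superset:
  assumes "finite W" "Poly_Mapping.keys p \<subseteq> W"
  shows "linear_extension g p = (\<Sum>w\<in>W. Poly_Mapping.lookup p w *\<^sub>R g w)"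
  unfolding linear_extension_def
  using assms by (intro sum.mono_neutral_left) (auto simp: in_keys_iff)

lemma linear_linear_extension: "linear (linear_extension g)"
proof (rule linearI)
  fix p q :: "'a ncpoly" and c :: real
  let ?W = "Poly_Mapping.keys p \<union> Poly_Mapping.keys q"
  have "Poly_Mapping.keys (p + q) \<subseteq> ?W"
    by (rule Poly_Mapping.keys_add)
  then show "linear_extension g (p + q) = linear_extension g p + linear_extension g q"
    by (simp add: linear_extension_superset[of ?W] lookup_add scaleR_add_left sum.distrib)
  have "Poly_Mapping.keys (c *\<^sub>R p) \<subseteq> Poly_Mapping.keys p"
    by (auto simp: in_keys_iff)
  then show "linear_extension g (c *\<^sub>R p) = c *\<^sub>R linear_extension g p"
    by (simp add: linear_extension_superset[of "Poly_Mapping.keys p"] scaleR_sum_right)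
qed

lemma linear_extension_monomial [simp]: "linear_extension g (monomial w) = g w"
  by (simp add: linear_extension_def monomial_def)

lemma linear_extension_id: "linear_extension monomial p = p"
proof (rule poly_mapping_eqI)
  fix w
  have lin: "linear (\<lambda>q :: 'a ncpoly. Poly_Mapping.lookup q w)"
    by (rule linearI) (simp_all add: lookup_add)
  have "Poly_Mapping.lookup (linear_extension monomial p) w
      = (\<Sum>v\<in>Poly_Mapping.keys p. Poly_Mapping.lookup p v * (if v = w then 1 else 0))"
    unfolding linear_extension_def linear_sum[OF lin]
    by (simp add: monomial_def lookup_single when_def)
  also have "\<dots> = Poly_Mapping.lookup p w"
    by (simp add: in_keys_iff if_distrib cong: if_cong)
  finally show "Poly_Mapping.lookup (linear_extension monomial p) w = Poly_Mapping.lookup p w" .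
qed

lemma linear_map_eq_linear_extension:
  assumes "linear f"
  shows "f p = linear_extension (\<lambda>w. f (monomial w)) p"
proof -
  have "f p = f (linear_extension monomial p)"
    by (simp add: linear_extension_id)
  also have "\<dots> = linear_extension (\<lambda>w. f (monomial w)) p"
    by (simp add: linear_extension_def linear_sum[OF assms] linear_scale[OF assms])
  finally show ?thesis .
qed

lemma ncpoly_linear_eqI:
  assumes "linear f" "linear g" "\<And>w. f (monomial w) = g (monomial w)"
  shows "f p = g p"
  using linear_map_eq_linear_extension[OF assms(1), of p]
    linear_map_eq_linear_extension[OF assms(2), of p]
  by (simp add: assms(3))

lemma monomial_mult: "monomial u * monomial v = monomial (u @ v)"
  by (simp add: monomial_def mult_single plus_list_def)

lemma monomial_Nil: "monomial [] = 1"
  by (simp add: monomial_def zero_list_def[symmetric])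

text \<open>
  Scaling is multiplication by a constant polynomial; bilinearity of the product then reduces to
  associativity and to the constants being central.
\<close>

lemma scaleR_ncpoly_eq_mult: "c *\<^sub>R p = Poly_Mapping.single 0 c * p" for p :: "'x ncpoly"
  unfolding mult_map_scale_conv_mult[symmetric] by transfer (simp add: fun_eq_iff when_def)

lemma scaleR_mult_ncpoly: "(c *\<^sub>R p) * q = c *\<^sub>R (p * q)" for p q :: "'x ncpoly"
  by (simp add: scaleR_ncpoly_eq_mult mult.assoc)

lemma ncpoly_induct [case_names monomial add scaleR]:
  fixes p :: "'x ncpoly"
  assumes "\<And>w. P (monomial w)" "\<And>p q. P p \<Longrightarrow> P q \<Longrightarrow> P (p + q)" "\<And>c p. P p \<Longrightarrow> P (c *\<^sub>R p)"
  shows "P p"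
proof -
  have zero: "P 0"
    using assms(3)[OF assms(1), of 0] by simp
  have "P (\<Sum>w\<in>W. Poly_Mapping.lookup p w *\<^sub>R monomial w)" if "finite W" for W
    using that by (induction W rule: finite_induct) (simp_all add: assms zero)
  then have "P (linear_extension monomial p)"
    by (simp add: linear_extension_def)
  then show ?thesis
    by (simp add: linear_extension_id)
qed

lemma mult_scaleR_ncpoly: "q * (c *\<^sub>R p) = c *\<^sub>R (q * p)" for p q :: "'x ncpoly"
proof -
  have "q * Poly_Mapping.single 0 c = c *\<^sub>R q"
  proof (induction q rule: ncpoly_induct)
    case (monomial w)
    show ?case
      by (simp add: monomial_def scaleR_ncpoly_eq_mult mult_single)
  qed (simp_all add: distrib_right scaleR_add_right scaleR_mult_ncpoly)
  then show ?thesis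
    by (simp add: scaleR_ncpoly_eq_mult[of c p] mult.assoc[symmetric] scaleR_mult_ncpoly)
qed

section \<open>Linear maps out of the tensor algebra\<close>

definition multilinear :: "('v::real_vector list \<Rightarrow> 'w::real_vector) \<Rightarrow> bool" where
  "multilinear g \<longleftrightarrow>
     (\<forall>as u v bs. g (as @ [u + v] @ bs) = g (as @ [u] @ bs) + g (as @ [v] @ bs)) \<and>
     (\<forall>as c u bs. g (as @ [c *\<^sub>R u] @ bs) = c *\<^sub>R g (as @ [u] @ bs))"

text \<open>
  The universal property of the tensor algebra, in all degrees at once: \<open>tensor_lift g\<close> takes the value
  \<open>g vs\<close> at \<open>tensor vs\<close>. It is evaluated at the representative that the quotient happens to choose,
  and is therefore meaningful for multilinear \<open>g\<close> only.
\<close>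

definition tensor_lift :: "('v::real_vector list \<Rightarrow> 'w::real_vector) \<Rightarrow> 'v tensor_algebra \<Rightarrow> 'w" where
  "tensor_lift g t = linear_extension g (rep_tensor_algebra t)"

text \<open>
  This makes \<open>tensor_lift g\<close> independent of the representative: multilinearity says precisely that
  the extension of \<open>g\<close> vanishes at the generators of the relations.
\<close>

lemma linear_extension_multilinear_relations:
  assumes "multilinear g" "p \<in> multilinear_relations"
  shows "linear_extension g p = 0"
  using assms(2) unfolding multilinear_relations_def
proof (induction rule: span_induct)
  case base
  show ?case
    using linear_subspace_kernel[OF linear_linear_extension[of g]] by simp
next
  case (step x)
  note lin = linear_linear_extension[of g]
  from step show ?case
    using assms(1)
    by (auto simp: multilinear_def linear_diff[OF lin] linear_scale[OF lin])
qed

lemma rep_abs_tensor_algebra: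
  "rep_tensor_algebra (abs_tensor_algebra p) - p \<in> multilinear_relations"
  using rep_abs_rsp_left[OF Quotient3_tensor_algebra, of p p] equivp_reflp[OF equivp_tensor_rel, of p]
  by (simp add: tensor_rel_def)

lemma tensor_lift_abs:
  assumes "multilinear g"
  shows "tensor_lift g (abs_tensor_algebra p) = linear_extension g p"
  using linear_extension_multilinear_relations[OF assms rep_abs_tensor_algebra[of p]]
  by (simp add: tensor_lift_def linear_diff[OF linear_linear_extension])

lemma tensor_algebra_cases: obtains p where "t = abs_tensor_algebra p"
  by (metis Quotient3_abs_rep Quotient3_tensor_algebra)

lemma linear_abs_tensor_algebra: "linear abs_tensor_algebra"
  by (rule linearI) (simp_all add: plus_tensor_algebra.abs_eq scaleR_tensor_algebra.abs_eq)

lemma tensor_lift_tensor: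
  assumes "multilinear g"
  shows "tensor_lift g (tensor vs) = g vs"
  using assms by (simp add: tensor.abs_eq tensor_lift_abs)

lemma linear_tensor_lift:
  assumes "multilinear g"
  shows "linear (tensor_lift g)"
proof (rule linearI)
  fix s t :: "'a tensor_algebra" and c :: real
  obtain p q where "s = abs_tensor_algebra p" "t = abs_tensor_algebra q"
    by (metis tensor_algebra_cases)
  note lin = linear_linear_extension[of g]
  with \<open>s = _\<close> \<open>t = _\<close> show "tensor_lift g (s + t) = tensor_lift g s + tensor_lift g t"
    by (simp add: plus_tensor_algebra.abs_eq tensor_lift_abs[OF assms] linear_add[OF lin])
  from \<open>s = _\<close> show "tensor_lift g (c *\<^sub>R s) = c *\<^sub>R tensor_lift g s"
    by (simp add: scaleR_tensor_algebra.abs_eq tensor_lift_abs[OF assms] linear_scale[OF lin])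
qed

text \<open>
  The elementary tensors span the tensor algebra, as they are the classes of the words.
\<close>

lemma tensor_linear_eqI:
  assumes "linear f" "linear g" "\<And>vs. f (tensor vs) = g (tensor vs)"
  shows "f t = g t"
proof -
  obtain p where t: "t = abs_tensor_algebra p"
    by (rule tensor_algebra_cases)
  show ?thesis unfolding t
    using ncpoly_linear_eqI[OF linear_compose[OF linear_abs_tensor_algebra assms(1)]
        linear_compose[OF linear_abs_tensor_algebra assms(2)], of p] assms(3)
    by (simp add: tensor.abs_eq)
qed

lemma multilinear_tensor: "multilinear tensor"
proof -
  have "abs_tensor_algebra p = abs_tensor_algebra q" if "p - q \<in> multilinear_relations" for p q :: "'a list \<Rightarrow>\<^sub>0 real"
    using that by (simp add: tensor_algebra.abs_eq_iff tensor_rel_def)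
  note eq = this
  have "tensor (as @ [u + v] @ bs) = tensor (as @ [u] @ bs) + tensor (as @ [v] @ bs)" for as bs and u v :: 'a
    unfolding tensor.abs_eq plus_tensor_algebra.abs_eq
    by (rule eq, unfold multilinear_relations_def, rule span_base) (auto simp: algebra_simps)
  moreover have "tensor (as @ [c *\<^sub>R u] @ bs) = c *\<^sub>R tensor (as @ [u] @ bs)" for as bs c and u :: 'a
    unfolding tensor.abs_eq scaleR_tensor_algebra.abs_eq
    by (rule eq, unfold multilinear_relations_def, rule span_base) blast
  ultimately show ?thesis unfolding multilinear_def by blast
qed

lemma multilinear_tensor_map:
  assumes "linear f"
  shows "multilinear (\<lambda>vs. tensor (map f vs))"
  using multilinear_tensor[where 'a='b]
  by (simp add: multilinear_def linear_add[OF assms] linear_scale[OF assms])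

lemma tensor_act_eq: "tensor_act f = tensor_lift (\<lambda>vs. tensor (map f vs))"
  by (simp add: fun_eq_iff tensor_act_def tensor_lift_def linear_extension_def Let_def)

text \<open>
  Multiplication by \<open>v\<close> from the left, on which inductions over the degree are based.
\<close>

definition tensor_cons :: "'v::real_vector \<Rightarrow> 'v tensor_algebra \<Rightarrow> 'v tensor_algebra" where
  "tensor_cons v = tensor_lift (\<lambda>vs. tensor (v # vs))"

lemma multilinear_tensor_Cons: "multilinear (\<lambda>vs. tensor (v # vs))"
  unfolding multilinear_def
proof (intro conjI allI)
  note M = multilinear_tensor[where 'a = 'a, unfolded multilinear_def]
  show "tensor (v # as @ [u + w] @ bs) = tensor (v # as @ [u] @ bs) + tensor (v # as @ [w] @ bs)"
    for as u w bs
    using M[THEN conjunct1, rule_format, of "v # as" u w bs] by simp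
  show "tensor (v # as @ [c *\<^sub>R u] @ bs) = c *\<^sub>R tensor (v # as @ [u] @ bs)" for as c u bs
    using M[THEN conjunct2, rule_format, of "v # as" c u bs] by simp
qed

lemma tensor_cons_tensor [simp]: "tensor_cons v (tensor vs) = tensor (v # vs)"
  by (simp add: tensor_cons_def tensor_lift_tensor multilinear_tensor_Cons)

lemma linear_tensor_cons: "linear (tensor_cons v)"
  by (simp add: tensor_cons_def linear_tensor_lift multilinear_tensor_Cons)

lemma linear_tensor_cons_left: "linear (\<lambda>v. tensor_cons v t)"
proof (rule linearI)
  have mult: "tensor ((u + v) # vs) = tensor (u # vs) + tensor (v # vs)"
    "tensor ((c *\<^sub>R u) # vs) = c *\<^sub>R tensor (u # vs)" for u v :: 'a and c vs
    using multilinear_tensor[where 'a='a] unfolding multilinear_def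
    by (auto dest: spec[of _ "[]"])
  note lin = linear_tensor_cons
  show "tensor_cons (u + v) t = tensor_cons u t + tensor_cons v t" for u v :: 'a
    by (rule tensor_linear_eqI) (simp_all add: lin linear_compose_add mult)
  show "tensor_cons (c *\<^sub>R u) t = c *\<^sub>R tensor_cons u t" for c and u :: 'a
    by (rule tensor_linear_eqI) (simp_all add: lin linear_compose_scale_right mult)
qed

lemma linear_tensor_act:
  assumes "linear f"
  shows "linear (tensor_act f)"
  unfolding tensor_act_eq by (rule linear_tensor_lift[OF multilinear_tensor_map[OF assms]])

lemma tensor_act_tensor:
  assumes "linear f"
  shows "tensor_act f (tensor vs) = tensor (map f vs)"
  unfolding tensor_act_eq by (rule tensor_lift_tensor[OF multilinear_tensor_map[OF assms]])

lemma tensor_act_compose: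
  assumes "linear f" "linear g"
  shows "tensor_act (f \<circ> g) t = tensor_act f (tensor_act g t)"
proof (rule tensor_linear_eqI[where f = "tensor_act (f \<circ> g)" and g = "\<lambda>t. tensor_act f (tensor_act g t)"])
  have fg: "linear (f \<circ> g)"
    using assms(2,1) by (rule linear_compose)
  then show "linear (tensor_act (f \<circ> g))"
    by (rule linear_tensor_act)
  show "linear (\<lambda>t. tensor_act f (tensor_act g t))"
    using linear_compose[OF linear_tensor_act linear_tensor_act] assms by (simp add: o_def)
  show "tensor_act (f \<circ> g) (tensor vs) = tensor_act f (tensor_act g (tensor vs))" for vs
    using assms fg by (simp add: tensor_act_tensor)
qed

lemma tensor_act_id: "tensor_act id t = t"
  by (rule tensor_linear_eqI[where g = "\<lambda>t. t"])
    (simp_all add: linear_tensor_act[OF linear_id] tensor_act_tensor[OF linear_id] linear_ident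
      list.map_id0 del: id_apply, simp)

lemma subspace_tensor_power: "subspace (tensor_power d)"
  by (simp add: tensor_power_def)

lemma tensor_in_tensor_power: "length vs = d \<Longrightarrow> tensor vs \<in> tensor_power d"
  unfolding tensor_power_def by (rule span_base) blast

lemma tensor_power_induct [consumes 1, case_names subspace tensor]:
  assumes "t \<in> tensor_power d" "subspace {t. P t}" "\<And>vs. length vs = d \<Longrightarrow> P (tensor vs)"
  shows "P t"
  using assms(1) unfolding tensor_power_def
  by (rule span_induct) (use assms(2,3) in auto)

lemma linear_image_subspace_tensor_power:
  assumes "linear f" "subspace S" "\<And>vs. length vs = d \<Longrightarrow> f (tensor vs) \<in> S" "t \<in> tensor_power d"
  shows "f t \<in> S"
  using assms(4)
proof (induction rule: tensor_power_induct)
  case subspace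
  show ?case
    using linear_subspace_vimage[OF assms(1,2)] by (simp add: vimage_def)
qed (rule assms(3))

lemma tensor_act_in_tensor_power:
  assumes "linear f" "t \<in> tensor_power d"
  shows "tensor_act f t \<in> tensor_power d"
  using linear_image_subspace_tensor_power[OF linear_tensor_act[OF assms(1)] subspace_tensor_power _ assms(2)]
  by (simp add: tensor_act_tensor[OF assms(1)] tensor_in_tensor_power)

lemma tensor_cons_in_tensor_power:
  assumes "t \<in> tensor_power d"
  shows "tensor_cons v t \<in> tensor_power (Suc d)"
  using linear_image_subspace_tensor_power[OF linear_tensor_cons subspace_tensor_power _ assms]
  by (simp add: tensor_in_tensor_power)

section \<open>The tensor algebra as an algebra of non-commutative polynomials\<close>

lemma linear_linear_form:
  assumes "is_basis b"
  shows "linear (linear_form b)"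
proof (rule linearI)
  note B = assms[unfolded is_basis_def]
  show "linear_form b (u + v) = linear_form b u + linear_form b v" for u v
    using B by (simp add: linear_form_def representation_add scaleR_add_left sum.distrib)
  show "linear_form b (c *\<^sub>R u) = c *\<^sub>R linear_form b u" for c u
    using B by (simp add: linear_form_def representation_scale scaleR_sum_right)
qed

lemma linear_form_basis:
  assumes "is_basis b"
  shows "linear_form b (b x) = monomial [x]"
proof -
  note B = assms[unfolded is_basis_def]
  have "representation (range b) (b x) (b i) = (if i = x then 1 else 0)" for i
    using B by (auto simp: representation_basis inj_eq)
  then have "linear_form b (b x) = (\<Sum>i\<in>UNIV. (if i = x then monomial [i] else 0))"
    unfolding linear_form_def by (intro sum.cong) auto
  then show ?thesis by simp
qed

text \<open>
  The algebra homomorphism that writes every vector as a linear form in the variables.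
\<close>

definition tensor_to_ncpoly :: "('x::finite \<Rightarrow> 'v::real_vector) \<Rightarrow> 'v tensor_algebra \<Rightarrow> 'x ncpoly" where
  "tensor_to_ncpoly b = tensor_lift (\<lambda>vs. prod_list (map (linear_form b) vs))"

lemma multilinear_prod_linear_forms:
  assumes "is_basis b"
  shows "multilinear (\<lambda>vs. prod_list (map (linear_form b) vs))"
  using linear_linear_form[OF assms]
  by (simp add: multilinear_def linear_add linear_scale distrib_left distrib_right
      scaleR_mult_ncpoly mult_scaleR_ncpoly)

lemma linear_tensor_to_ncpoly:
  assumes "is_basis b"
  shows "linear (tensor_to_ncpoly b)"
  unfolding tensor_to_ncpoly_def by (rule linear_tensor_lift[OF multilinear_prod_linear_forms[OF assms]])

lemma prod_list_variables: "prod_list (map (\<lambda>x. monomial [x]) xs) = monomial xs"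
  by (induction xs) (simp_all add: monomial_mult monomial_Nil)

lemma tensor_to_ncpoly_basis:
  assumes "is_basis b"
  shows "tensor_to_ncpoly b (tensor (map b xs)) = monomial xs"
  by (simp add: tensor_to_ncpoly_def tensor_lift_tensor[OF multilinear_prod_linear_forms[OF assms]]
      linear_form_basis[OF assms] o_def prod_list_variables)

text \<open>
  Expand the first factor in the basis and the remaining ones by induction.
\<close>

lemma tensor_in_span_basis_tensors:
  assumes "span (range b) = UNIV"
  shows "tensor vs \<in> span {tensor (map b xs) | xs. length xs = length vs}"
proof (induction vs)
  case Nil
  show ?case by (rule span_base) simp
next
  case (Cons v vs)
  let ?S = "\<lambda>n. span {tensor (map b xs) | xs. length xs = n}"
  have "tensor_cons (b x) t \<in> ?S (Suc n)" if "t \<in> ?S n" for x t n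
    using that
  proof (induction rule: span_induct)
    case base
    show ?case
      using linear_subspace_vimage[OF linear_tensor_cons subspace_span] by (simp add: vimage_def)
  next
    case (step t)
    then obtain xs where "t = tensor (map b xs)" "length xs = n"
      by blast
    then have "tensor_cons (b x) t = tensor (map b (x # xs))" "length (x # xs) = Suc n"
      by simp_all
    then show ?case
      by (intro span_base) blast
  qed
  from this[OF Cons] have basis: "tensor (b x # vs) \<in> ?S (Suc (length vs))" for x
    by simp
  have "v \<in> span (range b)"
    by (simp add: assms)
  then have "tensor_cons v (tensor vs) \<in> ?S (Suc (length vs))"
  proof (induction rule: span_induct)
    case base
    show ?case
      using linear_subspace_vimage[OF linear_tensor_cons_left[of "tensor vs"] subspace_span]
      by (simp add: vimage_def)
  next
    case (step v)
    then show ?case using basis by (auto simp del: length_Cons)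
  qed
  then show ?case by simp
qed

lemma tensor_linear_eqI_basis:
  assumes "linear f" "linear g" "span (range b) = UNIV"
    and "\<And>xs. f (tensor (map b xs)) = g (tensor (map b xs))"
  shows "f t = g t"
proof (rule tensor_linear_eqI[OF assms(1,2)])
  fix vs
  show "f (tensor vs) = g (tensor vs)"
    by (rule linear_eq_on_span[OF assms(1,2) _ tensor_in_span_basis_tensors[OF assms(3)]])
      (use assms(4) in auto)
qed

definition ncpoly_to_tensor :: "('x \<Rightarrow> 'v::real_vector) \<Rightarrow> 'x ncpoly \<Rightarrow> 'v tensor_algebra" where
  "ncpoly_to_tensor b = linear_extension (\<lambda>xs. tensor (map b xs))"

text \<open>
  Both composites are linear and fix a spanning family, the products of basis vectors on one side
  and the monomials on the other.
\<close>

lemma tensor_to_ncpoly_inverse: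
  assumes "is_basis b"
  shows "ncpoly_to_tensor b (tensor_to_ncpoly b t) = t"
    and "tensor_to_ncpoly b (ncpoly_to_tensor b p) = p"
proof -
  have lin: "linear (tensor_to_ncpoly b)" "linear (ncpoly_to_tensor b)"
    using linear_tensor_to_ncpoly[OF assms] linear_linear_extension
    by (simp_all add: ncpoly_to_tensor_def)
  have inv: "ncpoly_to_tensor b (monomial xs) = tensor (map b xs)" for xs
    by (simp add: ncpoly_to_tensor_def)
  show "ncpoly_to_tensor b (tensor_to_ncpoly b t) = t"
    using linear_compose[OF lin] assms
    by - (rule tensor_linear_eqI_basis[where b = b and g = "\<lambda>t. t"],
        simp_all add: o_def tensor_to_ncpoly_basis inv is_basis_def linear_ident)
  show "tensor_to_ncpoly b (ncpoly_to_tensor b p) = p"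
    using linear_compose[OF lin(2,1)] assms
    by - (rule ncpoly_linear_eqI[where g = "\<lambda>p. p"],
        simp_all add: o_def tensor_to_ncpoly_basis inv linear_ident)
qed

lemma subspace_homogeneous: "subspace (homogeneous d)"
proof (rule subspaceI)
  show "p + q \<in> homogeneous d" if "p \<in> homogeneous d" "q \<in> homogeneous d" for p q :: "'x ncpoly"
    using that Poly_Mapping.keys_add[of p q] by (auto simp: homogeneous_def)
  show "c *\<^sub>R p \<in> homogeneous d" if "p \<in> homogeneous d" for c and p :: "'x ncpoly"
    using that by (auto simp: homogeneous_def in_keys_iff)
qed (simp add: homogeneous_def)

lemma tensor_to_ncpoly_in_homogeneous_iff:
  fixes b :: "'x::finite \<Rightarrow> 'v::real_vector"
  assumes "is_basis b"
  shows "tensor_to_ncpoly b t \<in> homogeneous d \<longleftrightarrow> t \<in> tensor_power d"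
proof
  let ?T = "tensor_to_ncpoly b"
  assume "t \<in> tensor_power d"
  show "?T t \<in> homogeneous d"
  proof (rule linear_image_subspace_tensor_power[OF linear_tensor_to_ncpoly[OF assms]
        subspace_homogeneous _ \<open>t \<in> tensor_power d\<close>])
    fix vs :: "'v list"
    assume "length vs = d"
    then have "tensor vs \<in> span {tensor (map b xs) | xs. length xs = d}"
      using tensor_in_span_basis_tensors[of b vs] assms by (simp add: is_basis_def)
    then show "?T (tensor vs) \<in> homogeneous d"
    proof (induction rule: span_induct)
      case base
      show ?case
        using linear_subspace_vimage[OF linear_tensor_to_ncpoly[OF assms] subspace_homogeneous]
        by (simp add: vimage_def)
    next
      case (step t)
      then obtain xs where "t = tensor (map b xs)" "length xs = d"
        by blast
      then show ?case
        by (simp add: tensor_to_ncpoly_basis[OF assms] homogeneous_def monomial_def)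
    qed
  qed
next
  assume hom: "tensor_to_ncpoly b t \<in> homogeneous d"
  have "ncpoly_to_tensor b (tensor_to_ncpoly b t) \<in> tensor_power d"
    unfolding ncpoly_to_tensor_def linear_extension_def
    using hom
    by (intro subspace_sum subspace_scale subspace_tensor_power tensor_in_tensor_power)
      (simp add: homogeneous_def)
  then show "t \<in> tensor_power d"
    by (simp add: tensor_to_ncpoly_inverse[OF assms])
qed

text \<open>
  Equivariance. On a product of basis vectors both sides are the product of the linear forms of the
  images of the factors.
\<close>

lemma ncpoly_act_tensor_to_ncpoly:
  assumes "is_basis b" "linear f"
  shows "ncpoly_act b f (tensor_to_ncpoly b t) = tensor_to_ncpoly b (tensor_act f t)"
proof -
  have act: "ncpoly_act b f = linear_extension (\<lambda>w. prod_list (map (\<lambda>i. linear_form b (f (b i))) w))"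
    by (simp add: fun_eq_iff ncpoly_act_def ncpoly_subst_def linear_extension_def)
  have "linear (ncpoly_act b f)"
    unfolding act by (rule linear_linear_extension)
  then have "linear (\<lambda>t. ncpoly_act b f (tensor_to_ncpoly b t))"
    using linear_compose[OF linear_tensor_to_ncpoly[OF assms(1)]] by (simp add: o_def)
  moreover have "linear (\<lambda>t. tensor_to_ncpoly b (tensor_act f t))"
    using linear_compose[OF linear_tensor_act[OF assms(2)] linear_tensor_to_ncpoly[OF assms(1)]]
    by (simp add: o_def)
  moreover have "ncpoly_act b f (tensor_to_ncpoly b (tensor (map b xs)))
      = tensor_to_ncpoly b (tensor_act f (tensor (map b xs)))" for xs
    unfolding tensor_to_ncpoly_basis[OF assms(1)] tensor_act_tensor[OF assms(2)] act
    by (simp add: tensor_to_ncpoly_def tensor_lift_tensor[OF multilinear_prod_linear_forms[OF assms(1)]] o_def)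
  ultimately show ?thesis
    using assms(1) by - (rule tensor_linear_eqI_basis[where b = b], simp_all add: is_basis_def)
qed

lemma bij_betw_tensor_to_ncpoly_invariants:
  assumes "is_basis b" "\<And>g. g \<in> carrier G \<Longrightarrow> linear (\<rho> g)"
  shows "bij_betw (tensor_to_ncpoly b) (invariants G (\<lambda>g. tensor_act (\<rho> g)) (tensor_power d))
    (invariants G (\<lambda>g. ncpoly_act b (\<rho> g)) (homogeneous d))"
proof -
  have inj: "inj (tensor_to_ncpoly b)"
    using tensor_to_ncpoly_inverse(1)[OF assms(1)] by (metis injI)
  then have inv: "tensor_to_ncpoly b t \<in> invariants G (\<lambda>g. ncpoly_act b (\<rho> g)) (homogeneous d) \<longleftrightarrow>
      t \<in> invariants G (\<lambda>g. tensor_act (\<rho> g)) (tensor_power d)" for t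
    using assms
    by (auto simp: invariants_def tensor_to_ncpoly_in_homogeneous_iff ncpoly_act_tensor_to_ncpoly inj_eq)
  let ?A = "invariants G (\<lambda>g. tensor_act (\<rho> g)) (tensor_power d)"
  let ?B = "invariants G (\<lambda>g. ncpoly_act b (\<rho> g)) (homogeneous d)"
  have "p \<in> tensor_to_ncpoly b ` ?A" if "p \<in> ?B" for p
    using that inv[of "ncpoly_to_tensor b p"]
    by (intro image_eqI[of _ _ "ncpoly_to_tensor b p"])
      (simp_all add: tensor_to_ncpoly_inverse(2)[OF assms(1)])
  then have "tensor_to_ncpoly b ` ?A = ?B"
    using inv by blast
  then show ?thesis
    using inj by (auto simp: bij_betw_def inj_on_def)
qed

section \<open>Simultaneous eigenforms of the rotations\<close>

abbreviation sign :: "bool \<Rightarrow> int" where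
  "sign e \<equiv> (if e then 1 else - 1)"

definition weight :: "bool list \<Rightarrow> int" where
  "weight \<epsilon> = (\<Sum>e\<leftarrow>\<epsilon>. sign e)"

text \<open>
  The two eigenforms of all rotations. The phase \<open>- \<phi> / 2\<close> is chosen such that the reflection
  \<open>z \<mapsto> cis \<phi> * cnj z\<close> exchanges them without a further factor.
\<close>

definition eigenform :: "real \<Rightarrow> bool \<Rightarrow> complex \<Rightarrow> complex" where
  "eigenform \<phi> e v = (if e then cis (- \<phi> / 2) * v else cnj (cis (- \<phi> / 2) * v))"

definition eigentensor_form :: "real \<Rightarrow> bool list \<Rightarrow> complex list \<Rightarrow> complex" where
  "eigentensor_form \<phi> \<epsilon> vs =
     (if length \<epsilon> = length vs then prod_list (map2 (eigenform \<phi>) \<epsilon> vs) else 0)"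

text \<open>
  The coefficient of the complexified tensor at the product of eigenvectors given by \<open>\<epsilon>\<close>. It
  vanishes outside degree \<open>length \<epsilon>\<close>, because \<open>eigentensor_form\<close> is \<open>0\<close> on lists of another length.
\<close>

definition eigencoeff :: "real \<Rightarrow> bool list \<Rightarrow> complex tensor_algebra \<Rightarrow> complex" where
  "eigencoeff \<phi> \<epsilon> = tensor_lift (eigentensor_form \<phi> \<epsilon>)"

lemma eigenform_linear:
  "eigenform \<phi> e (u + v) = eigenform \<phi> e u + eigenform \<phi> e v"
  "eigenform \<phi> e (c *\<^sub>R v) = c *\<^sub>R eigenform \<phi> e v"
  by (simp_all add: eigenform_def distrib_left)

lemma eigentensor_form_simps [simp]:
  "eigentensor_form \<phi> [] [] = 1"
  "eigentensor_form \<phi> [] (v # vs) = 0"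
  "eigentensor_form \<phi> (e # \<epsilon>) [] = 0"
  "eigentensor_form \<phi> (e # \<epsilon>) (v # vs) = eigenform \<phi> e v * eigentensor_form \<phi> \<epsilon> vs"
  by (simp_all add: eigentensor_form_def)

lemma multilinear_eigentensor_form: "multilinear (eigentensor_form \<phi> \<epsilon>)"
  unfolding multilinear_def
proof (intro conjI allI)
  show "eigentensor_form \<phi> \<epsilon> (as @ [u + v] @ bs) =
      eigentensor_form \<phi> \<epsilon> (as @ [u] @ bs) + eigentensor_form \<phi> \<epsilon> (as @ [v] @ bs)" for as u v bs
  proof (induction as arbitrary: \<epsilon>)
    case Nil
    show ?case by (cases \<epsilon>) (simp_all add: eigenform_linear distrib_right)
  next
    case (Cons a as)
    then show ?case by (cases \<epsilon>) (simp_all add: distrib_left)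
  qed
  show "eigentensor_form \<phi> \<epsilon> (as @ [c *\<^sub>R u] @ bs) = c *\<^sub>R eigentensor_form \<phi> \<epsilon> (as @ [u] @ bs)" for as c u bs
  proof (induction as arbitrary: \<epsilon>)
    case Nil
    show ?case by (cases \<epsilon>) (simp_all add: eigenform_linear)
  next
    case (Cons a as)
    then show ?case by (cases \<epsilon>) simp_all
  qed
qed

lemma linear_eigencoeff: "linear (eigencoeff \<phi> \<epsilon>)"
  unfolding eigencoeff_def by (rule linear_tensor_lift[OF multilinear_eigentensor_form])

lemma eigencoeff_tensor [simp]: "eigencoeff \<phi> \<epsilon> (tensor vs) = eigentensor_form \<phi> \<epsilon> vs"
  unfolding eigencoeff_def by (rule tensor_lift_tensor[OF multilinear_eigentensor_form])

lemma eigencoeff_tensor_cons [simp]: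
  "eigencoeff \<phi> [] (tensor_cons v t) = 0"
  "eigencoeff \<phi> (e # \<epsilon>) (tensor_cons v t) = eigenform \<phi> e v * eigencoeff \<phi> \<epsilon> t"
proof -
  note lin = linear_compose[OF linear_tensor_cons linear_eigencoeff, unfolded o_def]
  show "eigencoeff \<phi> [] (tensor_cons v t) = 0"
    by (rule tensor_linear_eqI[where g = "\<lambda>_. 0", OF lin module_hom_zero]) simp
  have "linear (\<lambda>t. eigenform \<phi> e v * eigencoeff \<phi> \<epsilon> t)"
    using linear_eigencoeff[of \<phi> \<epsilon>] by (simp add: linear_iff distrib_left)
  then show "eigencoeff \<phi> (e # \<epsilon>) (tensor_cons v t) = eigenform \<phi> e v * eigencoeff \<phi> \<epsilon> t"
    by (rule tensor_linear_eqI[OF lin]) simp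
qed

text \<open>
  The tensors are real and the two eigenforms are conjugate to each other.
\<close>

lemma eigencoeff_Not: "eigencoeff \<phi> (map Not \<epsilon>) t = cnj (eigencoeff \<phi> \<epsilon> t)"
proof (rule tensor_linear_eqI[where f = "eigencoeff \<phi> (map Not \<epsilon>)" and g = "\<lambda>t. cnj (eigencoeff \<phi> \<epsilon> t)"])
  show "linear (eigencoeff \<phi> (map Not \<epsilon>))"
    by (rule linear_eigencoeff)
  show "linear (\<lambda>t. cnj (eigencoeff \<phi> \<epsilon> t))"
    using linear_eigencoeff[of \<phi> \<epsilon>] by (simp add: linear_iff)
  fix vs
  have "eigentensor_form \<phi> (map Not \<epsilon>) vs = cnj (eigentensor_form \<phi> \<epsilon> vs)"
  proof (induction \<epsilon> arbitrary: vs)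
    case Nil
    show ?case by (cases vs) simp_all
  next
    case (Cons e \<epsilon>)
    then show ?case by (cases vs) (simp_all add: eigenform_def)
  qed
  then show "eigencoeff \<phi> (map Not \<epsilon>) (tensor vs) = cnj (eigencoeff \<phi> \<epsilon> (tensor vs))"
    by simp
qed

lemma eigencoeff_rotation:
  "eigencoeff \<phi> \<epsilon> (tensor_act (\<lambda>z. cis \<alpha> * z) t) = cis (of_int (weight \<epsilon>) * \<alpha>) * eigencoeff \<phi> \<epsilon> t"
proof (rule tensor_linear_eqI)
  have rot: "linear (\<lambda>z. cis \<alpha> * z)"
    by (simp add: linear_iff distrib_left)
  show "linear (\<lambda>t. eigencoeff \<phi> \<epsilon> (tensor_act (\<lambda>z. cis \<alpha> * z) t))"
    using linear_compose[OF linear_tensor_act[OF rot] linear_eigencoeff] by (simp add: o_def)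
  show "linear (\<lambda>t. cis (of_int (weight \<epsilon>) * \<alpha>) * eigencoeff \<phi> \<epsilon> t)"
    using linear_eigencoeff[of \<phi> \<epsilon>] by (simp add: linear_iff distrib_left)
  fix vs
  have "eigentensor_form \<phi> \<epsilon> (map (\<lambda>z. cis \<alpha> * z) vs) =
      cis (of_int (weight \<epsilon>) * \<alpha>) * eigentensor_form \<phi> \<epsilon> vs"
  proof (induction \<epsilon> arbitrary: vs)
    case Nil
    show ?case by (cases vs) (simp_all add: weight_def)
  next
    case (Cons e \<epsilon>)
    have weight: "cis (of_int (weight (e # \<epsilon>)) * \<alpha>) =
        (if e then cis \<alpha> else cis (- \<alpha>)) * cis (of_int (weight \<epsilon>) * \<alpha>)"
      by (simp add: weight_def cis_mult algebra_simps)
    show ?case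
      by (cases vs) (simp_all add: eigenform_def Cons.IH weight cis_cnj)
  qed
  then show "eigencoeff \<phi> \<epsilon> (tensor_act (\<lambda>z. cis \<alpha> * z) (tensor vs)) =
      cis (of_int (weight \<epsilon>) * \<alpha>) * eigencoeff \<phi> \<epsilon> (tensor vs)"
    by (simp add: tensor_act_tensor[OF rot])
qed

lemma linear_reflection: "linear (\<lambda>z. cis \<phi> * cnj z)"
  by (simp add: linear_iff distrib_left)

lemma eigencoeff_reflection:
  "eigencoeff \<phi> \<epsilon> (tensor_act (\<lambda>z. cis \<phi> * cnj z) t) = eigencoeff \<phi> (map Not \<epsilon>) t"
proof (rule tensor_linear_eqI)
  show "linear (\<lambda>t. eigencoeff \<phi> \<epsilon> (tensor_act (\<lambda>z. cis \<phi> * cnj z) t))"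
    using linear_compose[OF linear_tensor_act[OF linear_reflection] linear_eigencoeff]
    by (simp add: o_def)
  show "linear (eigencoeff \<phi> (map Not \<epsilon>))"
    by (rule linear_eigencoeff)
  fix vs
  have swap: "eigenform \<phi> e (cis \<phi> * cnj v) = eigenform \<phi> (\<not> e) v" for e v
    by (simp add: eigenform_def cis_cnj mult.assoc[symmetric] cis_mult)
  have "eigentensor_form \<phi> \<epsilon> (map (\<lambda>z. cis \<phi> * cnj z) vs) = eigentensor_form \<phi> (map Not \<epsilon>) vs"
  proof (induction \<epsilon> arbitrary: vs)
    case Nil
    show ?case by (cases vs) simp_all
  next
    case (Cons e \<epsilon>)
    then show ?case by (cases vs) (simp_all add: swap)
  qed
  then show "eigencoeff \<phi> \<epsilon> (tensor_act (\<lambda>z. cis \<phi> * cnj z) (tensor vs)) =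
      eigencoeff \<phi> (map Not \<epsilon>) (tensor vs)"
    by (simp add: tensor_act_tensor[OF linear_reflection])
qed

text \<open>
  The real part of \<open>z\<close> times the product of the eigenvectors dual to \<open>eigenform \<phi>\<close>, written without
  complexifying. With \<open>e1 = cis (\<phi> / 2)\<close> and \<open>e2 = cis (\<phi> / 2) * \<i>\<close>, the vectors with
  \<open>eigenform \<phi> True\<close> equal to \<open>1\<close> and \<open>\<i>\<close>, these eigenvectors are \<open>(e1 - \<i> e2) / 2\<close> for \<open>True\<close> and
  \<open>(e1 + \<i> e2) / 2\<close> for \<open>False\<close>; their scalars are passed on to \<open>z\<close>.
\<close>

primrec eigentensor :: "real \<Rightarrow> bool list \<Rightarrow> complex \<Rightarrow> complex tensor_algebra" where
  "eigentensor \<phi> [] z = Re z *\<^sub>R tensor []"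
| "eigentensor \<phi> (e # \<epsilon>) z = (1 / 2) *\<^sub>R
     (tensor_cons (cis (\<phi> / 2)) (eigentensor \<phi> \<epsilon> z) +
      tensor_cons (cis (\<phi> / 2) * \<i>) (eigentensor \<phi> \<epsilon> ((if e then - \<i> else \<i>) * z)))"

lemma linear_eigentensor: "linear (eigentensor \<phi> \<epsilon>)"
proof (induction \<epsilon>)
  case Nil
  show ?case by (simp add: linear_iff scaleR_add_left)
next
  case (Cons e \<epsilon>)
  note lin = Cons[THEN linear_add] Cons[THEN linear_scale]
    linear_add[OF linear_tensor_cons] linear_scale[OF linear_tensor_cons]
  show ?case
    by (simp add: linear_iff lin distrib_left scaleR_add_right)
qed

lemma eigentensor_in_tensor_power: "eigentensor \<phi> \<epsilon> z \<in> tensor_power (length \<epsilon>)"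
proof (induction \<epsilon> arbitrary: z)
  case Nil
  show ?case
    by (simp add: subspace_scale subspace_tensor_power tensor_in_tensor_power)
next
  case (Cons e \<epsilon>)
  then show ?case
    by (simp add: subspace_scale subspace_add subspace_tensor_power tensor_cons_in_tensor_power)
qed

text \<open>
  A real part is half of a complex number plus its conjugate, and the conjugate sits at the
  opposite signs. Both terms can only meet for the empty list.
\<close>

lemma eigencoeff_eigentensor:
  "eigencoeff \<phi> \<delta> (eigentensor \<phi> \<epsilon> z) =
     ((if \<delta> = \<epsilon> then z else 0) + (if \<delta> = map Not \<epsilon> then cnj z else 0)) / 2"
proof (induction \<epsilon> arbitrary: \<delta> z)
  case Nil
  show ?case
    by (cases \<delta>) (simp_all add: linear_scale[OF linear_eigencoeff] complex_eq_iff)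
next
  case (Cons e \<epsilon>)
  note lin = linear_add[OF linear_eigencoeff] linear_scale[OF linear_eigencoeff]
  show ?case
  proof (cases \<delta>)
    case Nil
    then show ?thesis by (simp add: lin)
  next
    case (Cons e' \<delta>')
    have "eigenform \<phi> e' (cis (\<phi> / 2)) = 1" "eigenform \<phi> e' (cis (\<phi> / 2) * \<i>) = (if e' then \<i> else - \<i>)"
      by (simp_all add: eigenform_def mult.assoc[symmetric] cis_mult cis_cnj)
    then show ?thesis
      by (simp add: Cons lin Cons.IH scaleR_conv_of_real field_simps)
  qed
qed

lemma sum_lists_Suc:
  "(\<Sum>\<epsilon> | length \<epsilon> = Suc d. f \<epsilon>) = (\<Sum>\<epsilon> | length \<epsilon> = d. f (True # \<epsilon>) + f (False # \<epsilon>))"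
  for f :: "bool list \<Rightarrow> 'a::comm_monoid_add"
proof -
  let ?L = "{\<epsilon> :: bool list. length \<epsilon> = d}"
  have fin: "finite ?L"
    using finite_lists_length_eq[of "UNIV :: bool set" d] by simp
  have "{\<epsilon> :: bool list. length \<epsilon> = Suc d} = (#) True ` ?L \<union> (#) False ` ?L"
    by (auto simp: length_Suc_conv image_iff)
  then have "(\<Sum>\<epsilon> | length \<epsilon> = Suc d. f \<epsilon>) = sum f ((#) True ` ?L) + sum f ((#) False ` ?L)"
    using fin by (simp only:) (rule sum.union_disjoint, auto)
  then show ?thesis
    by (simp add: sum.reindex sum.distrib)
qed

text \<open>
  A real tensor is the sum of its components along the products of eigenvectors; it equals its
  real part, so the sum of the real parts of the components is the tensor again. In particular the
  coefficients determine the tensor.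
\<close>

lemma tensor_power_eigen_expansion:
  assumes "t \<in> tensor_power d"
  shows "t = (\<Sum>\<epsilon> | length \<epsilon> = d. eigentensor \<phi> \<epsilon> (eigencoeff \<phi> \<epsilon> t))"
  using assms
proof (induction rule: tensor_power_induct)
  case subspace
  have "linear (\<lambda>t. \<Sum>\<epsilon> | length \<epsilon> = d. eigentensor \<phi> \<epsilon> (eigencoeff \<phi> \<epsilon> t))"
    using linear_compose[OF linear_eigencoeff linear_eigentensor]
    by (intro linear_compose_sum) (simp add: o_def)
  from linear_subspace_kernel[OF linear_compose_sub[OF linear_ident this]] show ?case
    by simp
next
  case (tensor vs)
  then show ?case
  proof (induction vs arbitrary: d)
    case Nil
    have "{\<epsilon> :: bool list. length \<epsilon> = d} = {[]}"
      using Nil by auto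
    then show ?case by simp
  next
    case (Cons v vs)
    \<comment> \<open>The eigenforms of \<open>v\<close> are \<open>z\<close> and \<open>cnj z\<close>, so \<open>Re z\<close> and \<open>Im z\<close> are its coordinates for the two
      vectors in the definition of \<open>eigentensor\<close>.\<close>
    define z where "z = cis (- \<phi> / 2) * v"
    have v: "v = Re z *\<^sub>R cis (\<phi> / 2) + Im z *\<^sub>R (cis (\<phi> / 2) * \<i>)"
    proof -
      have "v = cis (\<phi> / 2) * z"
        by (simp add: z_def mult.assoc[symmetric] cis_mult)
      also have "\<dots> = cis (\<phi> / 2) * (of_real (Re z) + \<i> * of_real (Im z))"
        by (simp flip: complex_eq)
      finally show ?thesis
        by (simp add: scaleR_conv_of_real algebra_simps)
    qed
    let ?L = "eigentensor \<phi>" and ?c = "\<lambda>\<epsilon>. eigentensor_form \<phi> \<epsilon> vs"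
    note lin = linear_add[OF linear_eigentensor] linear_scale[OF linear_eigentensor]
      linear_scale[OF linear_tensor_cons] linear_add[OF linear_tensor_cons]
    have pair: "?L (True # \<epsilon>) (z * ?c \<epsilon>) + ?L (False # \<epsilon>) (cnj z * ?c \<epsilon>) =
        Re z *\<^sub>R tensor_cons (cis (\<phi> / 2)) (?L \<epsilon> (?c \<epsilon>)) +
        Im z *\<^sub>R tensor_cons (cis (\<phi> / 2) * \<i>) (?L \<epsilon> (?c \<epsilon>))" for \<epsilon>
    proof -
      have "z * c + cnj z * c = (2 * Re z) *\<^sub>R c" "- \<i> * (z * c) + \<i> * (cnj z * c) = (2 * Im z) *\<^sub>R c" for c
        by (simp_all add: complex_eq_iff algebra_simps)
      note eq = this[of "?c \<epsilon>"]
      have "?L (True # \<epsilon>) (z * ?c \<epsilon>) + ?L (False # \<epsilon>) (cnj z * ?c \<epsilon>) = (1 / 2) *\<^sub>R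
          (tensor_cons (cis (\<phi> / 2)) (?L \<epsilon> (z * ?c \<epsilon> + cnj z * ?c \<epsilon>)) +
           tensor_cons (cis (\<phi> / 2) * \<i>) (?L \<epsilon> (- \<i> * (z * ?c \<epsilon>) + \<i> * (cnj z * ?c \<epsilon>))))"
        unfolding lin by (simp add: scaleR_add_right)
      then show ?thesis
        unfolding eq lin by (simp add: scaleR_add_right)
    qed
    have "(\<Sum>\<epsilon> | length \<epsilon> = d. ?L \<epsilon> (eigencoeff \<phi> \<epsilon> (tensor (v # vs)))) =
        (\<Sum>\<epsilon> | length \<epsilon> = length vs. ?L (True # \<epsilon>) (z * ?c \<epsilon>) + ?L (False # \<epsilon>) (cnj z * ?c \<epsilon>))"
      unfolding Cons.prems[symmetric] length_Cons sum_lists_Suc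
      by (simp add: eigenform_def z_def del: eigentensor.simps)
    also have "\<dots> = Re z *\<^sub>R tensor_cons (cis (\<phi> / 2)) (\<Sum>\<epsilon> | length \<epsilon> = length vs. ?L \<epsilon> (?c \<epsilon>)) +
        Im z *\<^sub>R tensor_cons (cis (\<phi> / 2) * \<i>) (\<Sum>\<epsilon> | length \<epsilon> = length vs. ?L \<epsilon> (?c \<epsilon>))"
      unfolding pair by (simp add: sum.distrib scaleR_sum_right linear_sum[OF linear_tensor_cons])
    also have "(\<Sum>\<epsilon> | length \<epsilon> = length vs. ?L \<epsilon> (?c \<epsilon>)) = tensor vs"
      using Cons.IH[OF HOL.refl] by simp
    also have "Re z *\<^sub>R tensor_cons (cis (\<phi> / 2)) (tensor vs) +
        Im z *\<^sub>R tensor_cons (cis (\<phi> / 2) * \<i>) (tensor vs) = tensor_cons v (tensor vs)"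
      by (rule HOL.trans[OF _ arg_cong[OF v[symmetric], of "\<lambda>u. tensor_cons u (tensor vs)"]])
        (simp only: linear_add[OF linear_tensor_cons_left] linear_scale[OF linear_tensor_cons_left])
    finally show ?case
      by simp
  qed
qed

lemma tensor_power_eqI:
  assumes "s \<in> tensor_power d" "t \<in> tensor_power d"
    and "\<And>\<epsilon>. length \<epsilon> = d \<Longrightarrow> eigencoeff \<phi> \<epsilon> s = eigencoeff \<phi> \<epsilon> t"
  shows "s = t"
proof -
  have "s = (\<Sum>\<epsilon> | length \<epsilon> = d. eigentensor \<phi> \<epsilon> (eigencoeff \<phi> \<epsilon> s))"
    by (rule tensor_power_eigen_expansion[OF assms(1)])
  also have "\<dots> = (\<Sum>\<epsilon> | length \<epsilon> = d. eigentensor \<phi> \<epsilon> (eigencoeff \<phi> \<epsilon> t))"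
    by (rule sum.cong) (simp_all add: assms(3))
  also have "\<dots> = t"
    by (rule tensor_power_eigen_expansion[OF assms(2), symmetric])
  finally show ?thesis .
qed

lemma eigentensor_Not: "eigentensor \<phi> (map Not \<epsilon>) (of_real c) = eigentensor \<phi> \<epsilon> (of_real c)"
proof (rule tensor_power_eqI[where \<phi> = \<phi>])
  show "eigentensor \<phi> (map Not \<epsilon>) (of_real c) \<in> tensor_power (length \<epsilon>)"
    using eigentensor_in_tensor_power[of \<phi> "map Not \<epsilon>"] by simp
  show "eigentensor \<phi> \<epsilon> (of_real c) \<in> tensor_power (length \<epsilon>)"
    by (rule eigentensor_in_tensor_power)
qed (simp add: eigencoeff_eigentensor o_def add.commute)

lemma weight_Not: "weight (map Not \<epsilon>) = - weight \<epsilon>"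
  by (induction \<epsilon>) (simp_all add: weight_def)

section \<open>Words in a rotation and a reflection\<close>

lemma cis_root_of_unity_eq_1_iff:
  assumes "m > 0"
  shows "cis (2 * pi * of_int k / real m) = 1 \<longleftrightarrow> int m dvd k"
proof -
  have "cis (2 * pi * of_int k / real m) = 1 \<longleftrightarrow>
      (\<exists>n::int. 2 * pi * of_int k / real m = of_int (2 * n) * pi)"
    by (simp add: cis_conv_exp exp_eq_1)
  also have "\<dots> \<longleftrightarrow> (\<exists>n::int. real_of_int k = real_of_int (int m * n))"
    using assms by (intro ex_cong1) (auto simp: field_simps)
  also have "\<dots> \<longleftrightarrow> int m dvd k"
    unfolding of_int_eq_iff dvd_def ..
  finally show ?thesis .
qed

lemma pres_eq_insert_left: "pres_eq R u v \<Longrightarrow> pres_eq R (a @ u) (a @ v)"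
  using pres_eq.cong[of R u v a "[]"] by simp

lemma pres_eq_insert_right: "pres_eq R u v \<Longrightarrow> pres_eq R (u @ b) (v @ b)"
  using pres_eq.cong[of R u v "[]" b] by simp

abbreviation dihedral_eq :: "nat \<Rightarrow> dihedral_gen letter list \<Rightarrow> dihedral_gen letter list \<Rightarrow> bool" where
  "dihedral_eq m \<equiv> pres_eq (dihedral_relators m)"

abbreviation rots :: "nat \<Rightarrow> dihedral_gen letter list" where
  "rots k \<equiv> replicate k (Gen Rot)"

lemma dihedral_eq_rots_multiple:
  assumes "m dvd k"
  shows "dihedral_eq m (rots k) []"
proof -
  have "dihedral_eq m (rots (m * n)) []" for n
  proof (induction n)
    case 0
    show ?case by (simp add: pres_eq.refl)
  next
    case (Suc n)
    have "dihedral_eq m (rots m) []"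
      by (rule pres_eq.relator) (simp add: dihedral_relators_def)
    from pres_eq_append[OF this Suc.IH] show ?case
      by (simp add: replicate_add)
  qed
  with assms show ?thesis by (auto elim: dvdE)
qed

lemma dihedral_eq_Ref_Ref: "dihedral_eq m [Gen Ref, Gen Ref] []"
  by (rule pres_eq.relator) (simp add: dihedral_relators_def)

lemma dihedral_eq_Rot_Ref_Rot: "dihedral_eq m [Gen Rot, Gen Ref, Gen Rot] [Gen Ref]"
proof -
  have "dihedral_eq m [Gen Ref, Gen Rot, Gen Ref, Gen Rot] []"
    by (rule pres_eq.relator) (simp add: dihedral_relators_def)
  then have "dihedral_eq m [Gen Ref, Gen Ref, Gen Rot, Gen Ref, Gen Rot] [Gen Ref]"
    using pres_eq_insert_left[of _ _ _ "[Gen Ref]"] by fastforce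
  moreover have "dihedral_eq m [Gen Ref, Gen Ref, Gen Rot, Gen Ref, Gen Rot] [Gen Rot, Gen Ref, Gen Rot]"
    using pres_eq_insert_right[OF dihedral_eq_Ref_Ref, of m "[Gen Rot, Gen Ref, Gen Rot]"] by simp
  ultimately show ?thesis
    by (blast intro: pres_eq.sym pres_eq.trans)
qed

text \<open>
  The relation \<open>r s r = s\<close>, iterated. It states \<open>s r\<^sup>k = r\<^sup>-\<^sup>k s\<close> without inverses.
\<close>

lemma dihedral_eq_rots_Ref_rots: "dihedral_eq m (rots k @ [Gen Ref] @ rots k) [Gen Ref]"
proof (induction k)
  case 0
  show ?case by (simp add: pres_eq.refl)
next
  case (Suc k)
  have eq: "rots (Suc k) @ [Gen Ref] @ rots (Suc k) = [Gen Rot] @ (rots k @ [Gen Ref] @ rots k) @ [Gen Rot]"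
    by (simp add: replicate_append_same)
  show ?case
    unfolding eq
    by (rule pres_eq.trans[OF pres_eq.cong[OF Suc.IH]]) (simp add: dihedral_eq_Rot_Ref_Rot)
qed

lemma dihedral_eq_Ref_rots:
  assumes "m dvd j + k"
  shows "dihedral_eq m (Gen Ref # rots k) (rots j @ [Gen Ref])"
proof -
  have "dihedral_eq m (rots (j + k) @ Gen Ref # rots k) ([] @ Gen Ref # rots k)"
    by (rule pres_eq_insert_right[OF dihedral_eq_rots_multiple[OF assms]])
  moreover have "dihedral_eq m (rots (j + k) @ Gen Ref # rots k) (rots j @ [Gen Ref])"
    using pres_eq_insert_left[OF dihedral_eq_rots_Ref_rots[of m k], of "rots j"]
    by (simp add: replicate_add)
  ultimately show ?thesis
    by (auto intro: pres_eq.sym pres_eq.trans)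
qed

text \<open>
  The sign after each letter, starting from the sign \<open>e\<close>. A reflection is recorded with the sign
  that holds after it; the starting sign itself is left out.
\<close>

primrec orientations :: "bool \<Rightarrow> dihedral_gen list \<Rightarrow> bool list" where
  "orientations e [] = []"
| "orientations e (x # w) = (let e' = (e = (x = Rot)) in e' # orientations e' w)"

text \<open>
  The exponent of the rotation after all reflections of the word have been moved to the right.
\<close>

primrec turn :: "bool \<Rightarrow> dihedral_gen list \<Rightarrow> int" where
  "turn e [] = 0"
| "turn e (x # w) = (if x = Rot then sign e + turn e w else turn (\<not> e) w)"

abbreviation last_orientation :: "bool \<Rightarrow> dihedral_gen list \<Rightarrow> bool" where
  "last_orientation e w \<equiv> last (e # orientations e w)"

text \<open>
  The signs recorded at rotations add up to the exponent. A reflection changes the sign from \<open>- e\<close>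
  to the recorded \<open>e\<close>, which is half of the change, so the signs recorded at reflections add up to
  half of the difference between the final and the starting sign.
\<close>

lemma turn_eq_weight:
  "2 * turn e w = 2 * weight (orientations e w) + sign e - sign (last_orientation e w)"
  by (induction w arbitrary: e) (auto simp: weight_def Let_def)

lemma turn_Not: "turn (\<not> e) w = - turn e w"
  by (induction w arbitrary: e) auto

lemma orientations_Not: "orientations (\<not> e) w = map Not (orientations e w)"
proof (induction w arbitrary: e)
  case (Cons x w)
  show ?case
    using Cons.IH[of True] Cons.IH[of False] by (cases e; cases x) (simp_all add: Let_def)
qed simp

lemma last_orientation_Not: "last_orientation (\<not> e) w = (\<not> last_orientation e w)"
  by (simp add: orientations_Not last_map)

lemma length_orientations [simp]: "length (orientations e w) = length w"
  by (induction w arbitrary: e) (auto simp: Let_def)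

lemma inj_orientations: "orientations e v = orientations e w \<Longrightarrow> v = w"
proof (induction v arbitrary: e w)
  case Nil
  then show ?case by (cases w) (auto simp: Let_def)
next
  case (Cons x v)
  then obtain y w' where w: "w = y # w'"
    by (cases w) (auto simp: Let_def)
  with Cons.prems have "x = y"
    by (cases x; cases y) (auto simp: Let_def)
  with Cons w show ?case
    by (auto simp: Let_def)
qed

lemma surj_orientations: "\<exists>w. orientations e w = \<epsilon>"
proof (induction \<epsilon> arbitrary: e)
  case Nil
  show ?case by (rule exI[of _ "[]"]) simp
next
  case (Cons e' \<epsilon>)
  then obtain w where "orientations e' w = \<epsilon>"
    by blast
  then show ?case
    by (intro exI[of _ "(if e = e' then Rot else Ref) # w"]) (auto simp: Let_def)
qed

text \<open>
  By induction, putting a letter in front of the word: \<open>r\<close> raises the exponent by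
  one, and \<open>s\<close> negates it when it passes the rotations.
\<close>

lemma dihedral_normal_form:
  assumes "m > 0"
  shows "dihedral_eq m (map Gen w)
    (rots (nat (turn True w mod int m)) @ (if last_orientation True w then [] else [Gen Ref]))"
proof (induction w)
  case Nil
  show ?case by (simp add: pres_eq.refl)
next
  case (Cons x w)
  define k where "k = nat (turn True w mod int m)"
  define j where "j = nat (turn True (x # w) mod int m)"
  define f where "f = (if last_orientation True w then [] else [Gen Ref :: dihedral_gen letter])"
  define f' where "f' = (if last_orientation True (x # w) then [] else [Gen Ref :: dihedral_gen letter])"
  have k: "int k = turn True w mod int m" and j: "int j = turn True (x # w) mod int m"
    using assms by (simp_all add: k_def j_def)
  have "dihedral_eq m (Gen x # map Gen w) (Gen x # rots k @ f)"
    using pres_eq_insert_left[OF Cons.IH, of "[Gen x]"] by (simp add: k_def f_def)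
  moreover have "dihedral_eq m (Gen x # rots k @ f) (rots j @ f')"
  proof (cases x)
    case Rot
    have "f' = f"
      by (simp add: f_def f'_def Rot)
    have "int j = int (Suc k) mod int m"
      unfolding j Rot of_nat_Suc k by (simp add: mod_simps)
    then have "j = Suc k mod m"
      by (metis of_nat_eq_iff of_nat_mod)
    then have "Suc k = j + m * (Suc k div m)"
      by simp
    then have "Gen Rot # rots k = rots j @ rots (m * (Suc k div m))"
      by (metis replicate_Suc replicate_add)
    then have eq: "Gen Rot # rots k @ f = rots j @ rots (m * (Suc k div m)) @ f"
      by (metis append_Cons append_assoc)
    have "dihedral_eq m (rots (m * (Suc k div m))) []"
      by (rule dihedral_eq_rots_multiple) simp
    from pres_eq.cong[OF this, of "rots j" f] show ?thesis
      by (simp only: Rot \<open>f' = f\<close> eq append_Nil)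
  next
    case Ref
    have lo: "last_orientation True (x # w) = (\<not> last_orientation True w)"
      using last_orientation_Not[of True w] by (simp add: Ref Let_def)
    have "int j = (- int k) mod int m"
      using turn_Not[of True w] unfolding j k Ref by (simp add: mod_simps)
    then have "(int j + int k) mod int m = 0"
      by (simp add: mod_simps)
    then have "m dvd j + k"
      by (metis dvd_eq_mod_eq_0 of_nat_add of_nat_dvd_iff)
    then have "dihedral_eq m ((Gen Ref # rots k) @ f) ((rots j @ [Gen Ref]) @ f)"
      by (intro pres_eq_insert_right dihedral_eq_Ref_rots)
    moreover have "dihedral_eq m (rots j @ ([Gen Ref] @ f)) (rots j @ f')"
      unfolding f_def f'_def lo
      using dihedral_eq_Ref_Ref[of m] by (intro pres_eq_insert_left) (simp add: pres_eq.refl)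
    ultimately show ?thesis
      by (auto simp: Ref intro: pres_eq.trans)
  qed
  ultimately show ?case
    unfolding j_def f'_def by (auto intro: pres_eq.trans)
qed

lemma dihedral_group_simps:
  "\<one>\<^bsub>dihedral_group m\<^esub> = pres_class (dihedral_relators m) []"
  "carrier (dihedral_group m) = range (pres_class (dihedral_relators m))"
  "pres_class (dihedral_relators m) u \<otimes>\<^bsub>dihedral_group m\<^esub> pres_class (dihedral_relators m) v
     = pres_class (dihedral_relators m) (u @ v)"
  by (simp_all add: dihedral_group_def presented_group_mult) (simp_all add: presented_group_def)

lemma geometric_module_append:
  assumes "geometric_module m \<rho>"
  shows "\<rho> (pres_class (dihedral_relators m) (u @ v)) =
    \<rho> (pres_class (dihedral_relators m) u) \<circ> \<rho> (pres_class (dihedral_relators m) v)"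
  using assms by (simp add: geometric_module_def representation_on_def dihedral_group_simps(2)
      flip: dihedral_group_simps(3))

lemma geometric_module_Nil:
  assumes "geometric_module m \<rho>"
  shows "\<rho> (pres_class (dihedral_relators m) []) = id"
  using assms by (simp add: geometric_module_def representation_on_def dihedral_group_simps(1))

lemma geometric_module_rots:
  assumes "geometric_module m \<rho>"
  shows "\<rho> (pres_class (dihedral_relators m) (rots k)) z = cis (2 * pi * real k / real m) * z"
proof (induction k)
  case 0
  show ?case by (simp add: geometric_module_Nil[OF assms])
next
  case (Suc k)
  have "\<rho> (pres_class (dihedral_relators m) [Gen Rot]) = (\<lambda>z. cis (2 * pi / real m) * z)"
    using assms by (simp add: geometric_module_def rot_def)
  moreover have "2 * pi / real m + 2 * pi * real k / real m = 2 * pi * real (Suc k) / real m"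
    by (simp add: field_simps add_divide_distrib)
  ultimately show ?case
    using geometric_module_append[OF assms, of "[Gen Rot]" "rots k"] Suc
    by (simp add: mult.assoc[symmetric] cis_mult)
qed

text \<open>
  Sufficiency is the normal form. For necessity, the normal form is evaluated in the geometric
  module: a reflection is not the identity, and neither is a rotation by \<open>2 * pi * k / m\<close> with
  \<open>0 < k < m\<close>.
\<close>

lemma dihedral_word_trivial_iff:
  assumes "m > 0" "geometric_module m \<rho>"
  shows "dihedral_eq m (map Gen w) [] \<longleftrightarrow>
    last_orientation True w \<and> int m dvd weight (orientations True w)"
proof -
  let ?R = "dihedral_relators m"
  define k where "k = nat (turn True w mod int m)"
  have k: "int k = turn True w mod int m" "k < m"
    using assms(1) by (simp_all add: k_def nat_less_iff)
  have nf: "dihedral_eq m (map Gen w) (rots k @ (if last_orientation True w then [] else [Gen Ref]))"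
    unfolding k_def by (rule dihedral_normal_form[OF assms(1)])
  obtain \<phi> where ref: "\<rho> (pres_class ?R [Gen Ref]) = (\<lambda>z. cis \<phi> * cnj z)"
    using assms(2) by (auto simp: geometric_module_def ref_def)
  have "last_orientation True w \<and> k = 0"
    if "dihedral_eq m (map Gen w) []"
  proof -
    have "dihedral_eq m (rots k @ (if last_orientation True w then [] else [Gen Ref])) []"
      using that nf by (blast intro: pres_eq.sym pres_eq.trans)
    then have "\<rho> (pres_class ?R (rots k @ (if last_orientation True w then [] else [Gen Ref]))) = id"
      using geometric_module_Nil[OF assms(2)] by (metis pres_class_eq_iff)
    then have act: "cis (2 * pi * real k / real m) *
        \<rho> (pres_class ?R (if last_orientation True w then [] else [Gen Ref])) z = z" for z
      unfolding geometric_module_append[OF assms(2)]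
      using geometric_module_rots[OF assms(2)] by (metis comp_apply id_apply)
    have orient: "last_orientation True w"
    proof (rule ccontr)
      assume "\<not> last_orientation True w"
      \<comment> \<open>The images of \<open>1\<close> and \<open>\<i>\<close> under a reflection have the wrong orientation.\<close>
      with act[of 1] act[of \<i>] show False
        by (simp add: ref mult.assoc[symmetric])
    qed
    with act[of 1] have "cis (2 * pi * real k / real m) = 1"
      by (simp add: geometric_module_Nil[OF assms(2)] del: last.simps)
    then have "int m dvd int k"
      using cis_root_of_unity_eq_1_iff[OF assms(1), of "int k"] by simp
    with \<open>k < m\<close> have "k = 0"
      by (metis nat_dvd_not_less neq0_conv of_nat_dvd_iff)
    with orient show ?thesis by simp
  qed
  moreover have "dihedral_eq m (map Gen w) []" if "last_orientation True w" "k = 0"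
    using nf that by (simp del: last.simps)
  moreover have "turn True w = weight (orientations True w)" if "last_orientation True w"
    using turn_eq_weight[of True w] that by (simp del: last.simps)
  ultimately show ?thesis
    using k(1) by (metis dvd_eq_mod_eq_0 of_nat_eq_0_iff)
qed

lemma rot_neq_ref:
  assumes "geometric_module m \<rho>"
  shows "rot m \<noteq> ref m"
proof
  assume "rot m = ref m"
  with assms obtain \<phi> where "cis (2 * pi / real m) * z = cis \<phi> * cnj z" for z
    unfolding geometric_module_def by metis
  from this[of 1] this[of \<i>] show False
    by simp
qed

text \<open>
  Words are given here by classes of generators. As the two generators act differently on the plane,
  their classes differ, and such words correspond to words of letters and hence to sign lists.
\<close>

lemma card_words_reducing_to_one:
  assumes "m > 0" "geometric_module m \<rho>"
  shows "card (words_reducing_to (dihedral_group m) {rot m, ref m} d \<one>\<^bsub>dihedral_group m\<^esub>) =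
    card {\<epsilon>. length \<epsilon> = d \<and> last (True # \<epsilon>) \<and> int m dvd weight \<epsilon>}"
proof -
  let ?R = "dihedral_relators m" and ?G = "dihedral_group m"
  define gen where "gen x = pres_class ?R [Gen x]" for x
  have gens: "{rot m, ref m} = range gen"
  proof -
    have "(UNIV :: dihedral_gen set) = {Rot, Ref}"
      by (auto intro: dihedral_gen.exhaust)
    then have "range gen = gen ` {Rot, Ref}"
      by (simp only:)
    then show ?thesis
      by (simp add: gen_def rot_def ref_def)
  qed
  have "inj gen"
  proof (rule injI)
    fix x y assume "gen x = gen y"
    then show "x = y"
      using rot_neq_ref[OF assms(2)] by (cases x; cases y) (auto simp: gen_def rot_def ref_def)
  qed
  have prod: "foldr (\<lambda>x y. x \<otimes>\<^bsub>?G\<^esub> y) (map gen w) \<one>\<^bsub>?G\<^esub> = pres_class ?R (map Gen w)" for w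
    by (induction w) (simp_all add: gen_def dihedral_group_simps)
  then have one: "foldr (\<lambda>x y. x \<otimes>\<^bsub>?G\<^esub> y) (map gen w) \<one>\<^bsub>?G\<^esub> = \<one>\<^bsub>?G\<^esub> \<longleftrightarrow>
      dihedral_eq m (map Gen w) []" for w
    by (simp only: dihedral_group_simps(1) pres_class_eq_iff)
  let ?W = "{w. length w = d \<and> dihedral_eq m (map Gen w) []}"
  have "words_reducing_to ?G {rot m, ref m} d \<one>\<^bsub>?G\<^esub> = map gen ` ?W"
  proof -
    have "ws \<in> words_reducing_to ?G {rot m, ref m} d \<one>\<^bsub>?G\<^esub> \<longleftrightarrow> (\<exists>w\<in>?W. ws = map gen w)" for ws
    proof -
      have "ws \<in> words_reducing_to ?G {rot m, ref m} d \<one>\<^bsub>?G\<^esub> \<longleftrightarrow>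
          length ws = d \<and> (\<exists>w. ws = map gen w) \<and> foldr (\<lambda>x y. x \<otimes>\<^bsub>?G\<^esub> y) ws \<one>\<^bsub>?G\<^esub> = \<one>\<^bsub>?G\<^esub>"
        unfolding words_reducing_to_def gens ex_map_conv mem_Collect_eq
        by (simp add: subset_iff image_iff Ball_def)
      also have "\<dots> \<longleftrightarrow> (\<exists>w. length w = d \<and> ws = map gen w \<and>
          foldr (\<lambda>x y. x \<otimes>\<^bsub>?G\<^esub> y) (map gen w) \<one>\<^bsub>?G\<^esub> = \<one>\<^bsub>?G\<^esub>)"
        by (metis length_map)
      finally show ?thesis
        unfolding one Bex_def mem_Collect_eq by blast
    qed
    then show ?thesis
      by (intro Set.set_eqI) (simp add: image_iff)
  qed
  then have "card (words_reducing_to ?G {rot m, ref m} d \<one>\<^bsub>?G\<^esub>) = card ?W"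
    using \<open>inj gen\<close> by (simp add: card_image inj_on_def)
  also have "\<dots> = card (orientations True ` ?W)"
    by (rule card_image[symmetric]) (auto intro: inj_onI inj_orientations)
  also have "orientations True ` ?W = {\<epsilon>. length \<epsilon> = d \<and> last (True # \<epsilon>) \<and> int m dvd weight \<epsilon>}"
  proof -
    have "\<epsilon> \<in> orientations True ` ?W"
      if "length \<epsilon> = d" "last (True # \<epsilon>)" "int m dvd weight \<epsilon>" for \<epsilon>
    proof -
      obtain w where "orientations True w = \<epsilon>"
        using surj_orientations by blast
      with that show ?thesis
        by (intro image_eqI[of _ _ w]) (auto simp: dihedral_word_trivial_iff[OF assms] simp del: last.simps)
    qed
    then show ?thesis
      by (auto simp: dihedral_word_trivial_iff[OF assms] simp del: last.simps)
  qed
  finally show ?thesis .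
qed

section \<open>The dimension of the invariants\<close>

text \<open>
  The group elements are classes of words that may contain formal inverses; an inverse of a
  generator fixes what the generator fixes.
\<close>

lemma tensor_invariants_iff_generators:
  assumes "geometric_module m \<rho>"
  shows "t \<in> tensor_invariants m \<rho> d \<longleftrightarrow>
    t \<in> tensor_power d \<and> tensor_act (\<rho> (rot m)) t = t \<and> tensor_act (\<rho> (ref m)) t = t"
proof
  let ?R = "dihedral_relators m"
  show "t \<in> tensor_power d \<and> tensor_act (\<rho> (rot m)) t = t \<and> tensor_act (\<rho> (ref m)) t = t"
    if "t \<in> tensor_invariants m \<rho> d"
    using that by (simp add: tensor_invariants_def invariants_def dihedral_group_simps(2) rot_def ref_def)
  assume t: "t \<in> tensor_power d \<and> tensor_act (\<rho> (rot m)) t = t \<and> tensor_act (\<rho> (ref m)) t = t"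
  have lin: "linear (\<rho> (pres_class ?R u))" for u
    using assms by (simp add: geometric_module_def representation_on_def dihedral_group_simps(2))
  have app: "tensor_act (\<rho> (pres_class ?R (u @ v))) t =
      tensor_act (\<rho> (pres_class ?R u)) (tensor_act (\<rho> (pres_class ?R v)) t)" for u v
    by (simp add: geometric_module_append[OF assms] tensor_act_compose[OF lin lin])
  have nil: "tensor_act (\<rho> (pres_class ?R [])) t = t"
    by (simp add: geometric_module_Nil[OF assms] tensor_act_id)
  have gen: "tensor_act (\<rho> (pres_class ?R [Gen x])) t = t" for x
    using t by (cases x) (simp_all add: rot_def ref_def)
  have inv: "tensor_act (\<rho> (pres_class ?R [Inv x])) t = t" for x
  proof -
    have "pres_class ?R ([Inv x] @ [Gen x]) = pres_class ?R []"
      by (simp add: pres_class_eq_iff pres_eq.cancel_left)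
    then show ?thesis
      using app[of "[Inv x]" "[Gen x]"] gen nil by simp
  qed
  have "tensor_act (\<rho> (pres_class ?R u)) t = t" for u
  proof (induction u)
    case Nil
    show ?case by (rule nil)
  next
    case (Cons l u)
    then show ?case
      using app[of "[l]" u] gen inv by (cases l) simp_all
  qed
  with t show "t \<in> tensor_invariants m \<rho> d"
    by (auto simp: tensor_invariants_def invariants_def dihedral_group_simps(2))
qed

text \<open>
  The rotation acts diagonally on the coefficients and the reflection conjugates them.
\<close>

lemma tensor_invariants_iff_eigencoeff:
  assumes "m > 0" "geometric_module m \<rho>" "\<rho> (ref m) = (\<lambda>z. cis \<phi> * cnj z)"
  shows "t \<in> tensor_invariants m \<rho> d \<longleftrightarrow> t \<in> tensor_power d \<and>
    (\<forall>\<epsilon>. length \<epsilon> = d \<longrightarrow> Im (eigencoeff \<phi> \<epsilon> t) = 0 \<and> (int m dvd weight \<epsilon> \<or> eigencoeff \<phi> \<epsilon> t = 0))"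
proof (cases "t \<in> tensor_power d")
  case False
  then show ?thesis
    using tensor_invariants_iff_generators[OF assms(2)] by blast
next
  case t: True
  have rot: "\<rho> (rot m) = (\<lambda>z. cis (2 * pi / real m) * z)"
    using assms(2) by (simp add: geometric_module_def)
  have lin: "linear (\<lambda>z. cis (2 * pi / real m) * z)"
    by (simp add: linear_iff distrib_left)
  have fixed: "tensor_act f t = t \<longleftrightarrow>
      (\<forall>\<epsilon>. length \<epsilon> = d \<longrightarrow> eigencoeff \<phi> \<epsilon> (tensor_act f t) = eigencoeff \<phi> \<epsilon> t)" if "linear f" for f
    using tensor_power_eqI[OF tensor_act_in_tensor_power[OF that t] t] by metis
  have eigenvalue: "cis (of_int (weight \<epsilon>) * (2 * pi / real m)) = 1 \<longleftrightarrow> int m dvd weight \<epsilon>" for \<epsilon>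
    using cis_root_of_unity_eq_1_iff[OF assms(1), of "weight \<epsilon>"] by (simp add: mult_ac)
  have "tensor_act (\<rho> (rot m)) t = t \<longleftrightarrow>
      (\<forall>\<epsilon>. length \<epsilon> = d \<longrightarrow> int m dvd weight \<epsilon> \<or> eigencoeff \<phi> \<epsilon> t = 0)"
    unfolding rot fixed[OF lin] eigencoeff_rotation
    by (auto simp only: eigenvalue mult_cancel_right1 mult_cancel_right2 disj_commute)
  moreover have "tensor_act (\<rho> (ref m)) t = t \<longleftrightarrow>
      (\<forall>\<epsilon>. length \<epsilon> = d \<longrightarrow> Im (eigencoeff \<phi> \<epsilon> t) = 0)"
    unfolding assms(3) fixed[OF linear_reflection] eigencoeff_reflection eigencoeff_Not
    by (simp add: complex_eq_iff)
  ultimately show ?thesis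
    using t tensor_invariants_iff_generators[OF assms(2)] by blast
qed

text \<open>
  If \<open>f a\<close> were in the span of the others, then \<open>\<phi> a\<close> would vanish at it.
\<close>

lemma independent_if_dual_functionals:
  fixes f :: "'a \<Rightarrow> 'v::real_vector" and \<phi> :: "'a \<Rightarrow> 'v \<Rightarrow> 'w::real_vector"
  assumes "\<And>a. a \<in> A \<Longrightarrow> linear (\<phi> a)" "\<And>a. a \<in> A \<Longrightarrow> \<phi> a (f a) \<noteq> 0"
    and "\<And>a b. a \<in> A \<Longrightarrow> b \<in> A \<Longrightarrow> a \<noteq> b \<Longrightarrow> \<phi> a (f b) = 0"
  shows "inj_on f A" "independent (f ` A)"
proof -
  show "inj_on f A"
    using assms(2,3) by (metis inj_onI)
  have "f a \<notin> span (f ` A - {f a})" if a: "a \<in> A" for a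
  proof
    assume "f a \<in> span (f ` A - {f a})"
    then have "\<phi> a (f a) = 0"
    proof (induction rule: span_induct)
      case base
      show ?case
        using linear_subspace_kernel[OF assms(1)[OF a]] by simp
    next
      case (step v)
      then show ?case using assms(3)[OF a] by blast
    qed
    with assms(2)[OF a] show False by simp
  qed
  then show "independent (f ` A)"
    unfolding dependent_def by blast
qed

text \<open>
  The tensors \<open>eigentensor \<phi> \<epsilon> 1\<close> form a basis. Opposite signs give the same tensor
  (\<open>eigentensor_Not\<close>), and requiring the last sign to be \<open>True\<close> selects one list from each pair. Consing
  \<open>True\<close> in front makes the requirement hold for the empty list, which is its own opposite.
\<close>

lemma dim_tensor_invariants:
  assumes "m > 0" "geometric_module m \<rho>"
  shows "dim (tensor_invariants m \<rho> d) =
    card {\<epsilon>. length \<epsilon> = d \<and> last (True # \<epsilon>) \<and> int m dvd weight \<epsilon>}"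
proof -
  obtain \<phi> where ref: "\<rho> (ref m) = (\<lambda>z. cis \<phi> * cnj z)"
    using assms(2) by (auto simp: geometric_module_def)
  note inv_iff = tensor_invariants_iff_eigencoeff[OF assms ref]
  let ?A = "{\<epsilon>. length \<epsilon> = d \<and> last (True # \<epsilon>) \<and> int m dvd weight \<epsilon>}"
  let ?f = "\<lambda>\<epsilon>. eigentensor \<phi> \<epsilon> 1"
  have dual: "eigencoeff \<phi> \<delta> (?f \<epsilon>) = 0" if "\<delta> \<in> ?A" "\<epsilon> \<in> ?A" "\<delta> \<noteq> \<epsilon>" for \<delta> \<epsilon>
  proof -
    have "\<delta> \<noteq> map Not \<epsilon>"
      using that by (auto simp: last_map split: if_splits)
    with that(3) show ?thesis
      by (simp add: eigencoeff_eigentensor)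
  qed
  have diag: "eigencoeff \<phi> \<epsilon> (?f \<epsilon>) \<noteq> 0" for \<epsilon>
    by (simp add: eigencoeff_eigentensor)
  have basis: "inj_on ?f ?A" "independent (?f ` ?A)"
    by (rule independent_if_dual_functionals[of ?A "eigencoeff \<phi>" ?f,
          OF linear_eigencoeff diag dual], assumption+)+
  have "?f ` ?A \<subseteq> tensor_invariants m \<rho> d"
    using eigentensor_in_tensor_power
    by (auto simp: inv_iff eigencoeff_eigentensor weight_Not simp del: last.simps)
  moreover have "tensor_invariants m \<rho> d \<subseteq> span (?f ` ?A)"
  proof
    fix t assume "t \<in> tensor_invariants m \<rho> d"
    then have t: "t \<in> tensor_power d"
      and coeff: "\<And>\<epsilon>. length \<epsilon> = d \<Longrightarrow> Im (eigencoeff \<phi> \<epsilon> t) = 0"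
        "\<And>\<epsilon>. length \<epsilon> = d \<Longrightarrow> int m dvd weight \<epsilon> \<or> eigencoeff \<phi> \<epsilon> t = 0"
      by (auto simp: inv_iff)
    have summand: "eigentensor \<phi> \<epsilon> (eigencoeff \<phi> \<epsilon> t) \<in> span (?f ` ?A)" if "length \<epsilon> = d" for \<epsilon>
    proof (cases "int m dvd weight \<epsilon>")
      case False
      then show ?thesis
        using coeff(2)[OF that] by (simp add: linear_0[OF linear_eigentensor] span_zero)
    next
      case True
      have "eigencoeff \<phi> \<epsilon> t = Re (eigencoeff \<phi> \<epsilon> t) *\<^sub>R 1"
        using coeff(1)[OF that] by (simp add: complex_eq_iff)
      then have "eigentensor \<phi> \<epsilon> (eigencoeff \<phi> \<epsilon> t) = Re (eigencoeff \<phi> \<epsilon> t) *\<^sub>R ?f \<epsilon>"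
        by (metis linear_scale[OF linear_eigentensor])
      moreover have "?f \<epsilon> \<in> ?f ` ?A"
      proof (cases "last (True # \<epsilon>)")
        case True
        with that \<open>int m dvd weight \<epsilon>\<close> show ?thesis by blast
      next
        case False
        then have "map Not \<epsilon> \<in> ?A"
          using that \<open>int m dvd weight \<epsilon>\<close> by (auto simp: last_map weight_Not split: if_splits)
        then show ?thesis
          using eigentensor_Not[of \<phi> \<epsilon> 1] by (intro image_eqI[of _ _ "map Not \<epsilon>"]) simp_all
      qed
      ultimately show ?thesis
        by (simp add: span_base span_scale)
    qed
    have "(\<Sum>\<epsilon> | length \<epsilon> = d. eigentensor \<phi> \<epsilon> (eigencoeff \<phi> \<epsilon> t)) \<in> span (?f ` ?A)"
      by (rule span_sum) (rule summand, simp)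
    then show "t \<in> span (?f ` ?A)"
      using tensor_power_eigen_expansion[OF t, of \<phi>] by simp
  qed
  ultimately show ?thesis
    using basis(2) card_image[OF basis(1)] by (rule dim_unique)
qed

lemma dim_image_inj_linear:
  assumes "linear f" "inj f"
  shows "dim (f ` S) = dim S"
proof -
  obtain B where B: "B \<subseteq> S" "independent B" "S \<subseteq> span B" "card B = dim S"
    by (rule basis_exists)
  show ?thesis
  proof (rule dim_unique)
    show "f ` B \<subseteq> f ` S"
      using B(1) by blast
    show "f ` S \<subseteq> span (f ` B)"
      using B(3) by (auto simp: linear_span_image[OF assms(1)])
    show "independent (f ` B)"
      using assms B(2) by (intro linear_independent_injective_image) (auto intro: inj_on_subset)
    show "card (f ` B) = dim S"
      using assms(2) B(4) by (simp add: card_image inj_on_subset)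
  qed
qed

theorem corollary5p6:
  fixes m d :: nat
    and \<rho> :: "dihedral_gen letter list set \<Rightarrow> complex \<Rightarrow> complex"
    and b :: "ncvar \<Rightarrow> complex"
  assumes "m \<ge> 3"
    and "geometric_module m \<rho>"
    and "is_basis b"
  shows "(\<exists>\<Phi>. linear \<Phi> \<and> (\<forall>xs. \<Phi> (tensor (map b xs)) = monomial xs) \<and>
              bij_betw \<Phi> (tensor_invariants m \<rho> d) (ncpoly_invariants m \<rho> b d)) \<and>
         dim (tensor_invariants m \<rho> d) =
           card (words_reducing_to (dihedral_group m) {rot m, ref m} d \<one>\<^bsub>dihedral_group m\<^esub>) \<and>
         dim (ncpoly_invariants m \<rho> b d) =
           card (words_reducing_to (dihedral_group m) {rot m, ref m} d \<one>\<^bsub>dihedral_group m\<^esub>)"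
proof -
  let ?\<Phi> = "tensor_to_ncpoly b"
  have "m > 0"
    using assms(1) by simp
  have bij: "bij_betw ?\<Phi> (tensor_invariants m \<rho> d) (ncpoly_invariants m \<rho> b d)"
    unfolding tensor_invariants_def ncpoly_invariants_def
    using assms(2) by (intro bij_betw_tensor_to_ncpoly_invariants assms(3))
      (simp add: geometric_module_def representation_on_def)
  have "inj ?\<Phi>"
    using tensor_to_ncpoly_inverse(1)[OF assms(3)] by (metis injI)
  then have "dim (?\<Phi> ` tensor_invariants m \<rho> d) = dim (tensor_invariants m \<rho> d)"
    by (rule dim_image_inj_linear[OF linear_tensor_to_ncpoly[OF assms(3)]])
  then have "dim (ncpoly_invariants m \<rho> b d) = dim (tensor_invariants m \<rho> d)"
    using bij by (simp add: bij_betw_def)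
  then show ?thesis
    using bij linear_tensor_to_ncpoly[OF assms(3)] tensor_to_ncpoly_basis[OF assms(3)]
      dim_tensor_invariants[OF \<open>m > 0\<close> assms(2)] card_words_reducing_to_one[OF \<open>m > 0\<close> assms(2)]
    by auto
qed

end
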